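(* Let $\mu$ be any vertex of $\Gamma$ and let $\xi>0$ be a rational number. Then $\xi\in\mathcal H^{\mathfrak a}_\mu$ if and only if $$ h^{\mathfrak a}_\mu(\xi):=d_\mu\xi+(v_\Gamma(\mu)-2)V_{\mu,\mu}-\sum_{\nu\sim\mu}s^\mu_\nu\left\lceil\sum_{i\in\Gamma^\mu_\nu}\frac{\widehat d_iV_{\mu,i}}{s^\mu_\nu}\,\xi\right\rceil^{+}\in S^\mu . $$ Equivalently, $$ \mathcal H^{\mathfrak a}_\mu=\left\{\frac{t}{d_\mu}\;\middle|\; t+(v_\Gamma(\mu)-2)V_{\mu,\mu}-\sum_{\nu\sim\mu}s^\mu_\nu\left\lceil t\sum_{i\in\Gamma^\mu_\nu}\frac{\widehat d_iV_{\mu,i}}{s^\mu_\nu d_\mu}\right\rceil^{+}\in S^\mu\right\}. $$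
   Context: Setting: $R$ is a two-dimensional regular local ring with algebraically closed residue field and $\mathfrak a\subset R$ is a proper nonzero complete ideal of finite colength. Let $\pi:X=X_{N+1}\to X_N\to\cdots\to X_1=\operatorname{Spec}R$ be a composition of blowups $\pi_\mu:X_{\mu+1}\to X_\mu$ at closed points $x_\mu\in X_\mu$ such that $\mathfrak a\mathcal O_X=\mathcal O_X(-D)$ is invertible. $E_\mu$ (resp. $E^*_\mu$) denotes the strict (resp. total) transform on $X$ of $\pi_\mu^{-1}(x_\mu)$. We write $\mu\succ\nu$ ($x_\mu$ proximate to $x_\nu$) if $x_\mu$ lies on the strict transform on $X_\mu$ of $\pi_\nu^{-1}(x_\nu)$. The proximity matrix $P=(p_{\mu,\nu})$ has $p_{\mu,\mu}=1$, $p_{\mu,\nu}=-1$ if $\mu\succ\nu$, and $0$ otherwise; $Q=(q_{\mu,\nu})=P^{-1}$. Let $\{\widehat E_\nu\}$ be the basis of $\bigoplus_\nu\mathbb Q E_\nu$ dual to $\{E_\nu\}$ in the sense $E_\mu\cdot\widehat E_\nu=-\delta_{\mu,\nu}$, and $\mathfrak p_\nu\subset R$ the simple complete ideal with $\mathfrak p_\nu\mathcal O_X=\mathcal O_X(-\widehat E_\nu)$. The valuation matrix is $V=(P^{T}P)^{-1}$; it is symmetric with $V_{\mu,\nu}=v_\mu(\mathfrak p_\nu)$, where $v_\mu$ is the $\mathfrak m_{X_\mu,x_\mu}$-adic order valuation. For a divisor $G=\sum_\nu g_\nu E_\nu=\sum_\nu\widehat g_\nu\widehat E_\nu$ we have $g=\widehat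 gV$; $G$ is antinef if $\widehat g_\nu\ge0$ for all $\nu$. Write $\mathfrak a=\prod_\nu\mathfrak p_\nu^{\widehat d_\nu}$ and $D=\sum d_\nu E_\nu=\sum\widehat d_\nu\widehat E_\nu$. The canonical divisor is $K=\sum_\nu E^*_\nu=\sum_\nu k_\nu E_\nu$ with $k_\nu=\sum_\mu q_{\nu,\mu}$. Dual graph $\Gamma$: vertices $1,\dots,N$, with $\gamma\sim\eta$ (adjacent) iff $\gamma\neq\eta$ and $E_\gamma\cap E_\eta\neq\emptyset$; it is a tree. $v_\Gamma(\mu)$ is the number of vertices adjacent to $\mu$. For vertices $\mu,\nu$, the branch $\Gamma^\mu_\nu$ is the maximal connected subgraph of $\Gamma$ containing $\nu$ but not $\mu$ ($\Gamma^\mu_\mu=\emptyset$). Jumping numbers: for $F=\sum f_\nu E_\nu$, $G=\sum g_\nu E_\nu$ and a vertex $\nu$ put $\lambda(F,G;\nu)=(f_\nu+k_\nu+1)/g_\nu$. For an antinef $F$ with integer coefficients put $\xi_F=\min_\nu\lambda(F,D;\nu)$ (the jumping numbers of $\mathfrak a$ are exactly these numbers $\xi_F$). Define $\mathcal H^{\mathfrak a}_\mu=\{\xi_F\mid F\text{ antinef with integer coefficients},\ \xi_F=\lambda(F,D;\mu)\}$, the jumping numbers supported at $\mu$. Semigroups: $\mathcal{SV}^\mu_\nu$ is the submonoid of $\mathbb N$ generated by $\{V_{\mu,i}\mid i\in\Gamma^\mu_\nu\cup\{\mu\}\}$, $s^\mu_\nu=\gcd\mathcal{SV}^\mu_\nu$,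 and $S^\mu$ is the submonoid of $\mathbb N$ generated by $\{s^\mu_\nu\mid\nu\in\Gamma\}$ (so $S^\mu=\mathbb N$ if $\mu$ is the only vertex). $\lceil x\rceil^{+}$ denotes rounding $x$ up to the nearest positive integer, i.e. $\max(1,\lceil x\rceil)$. *)

theory Defs
  imports "Jordan_Normal_Form.Matrix"
begin

text \<open>Combinatorial model. Vertices (points x_1..x_N of the paper) are indexed 0..N-1
  (vertex i here = point x_(i+1)).  prox mu nu means x_mu is proximate to x_nu.\<close>

definition valid_prox :: "nat \<Rightarrow> (nat \<Rightarrow> nat \<Rightarrow> bool) \<Rightarrow> bool" where
  "valid_prox N prox \<longleftrightarrow>
     N \<ge> 1 \<and>
     (\<forall>mu nu. prox mu nu \<longrightarrow> nu < mu \<and> mu < N) \<and>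
     (\<forall>mu. 1 \<le> mu \<and> mu < N \<longrightarrow> card {nu. prox mu nu} \<in> {1, 2}) \<and>
     (\<forall>mu nu eta. prox mu nu \<and> prox mu eta \<and> nu < eta \<longrightarrow>
        prox eta nu \<and> \<not> (\<exists>rho. eta < rho \<and> rho < mu \<and> prox rho nu \<and> prox rho eta))"

definition Pmat :: "nat \<Rightarrow> (nat \<Rightarrow> nat \<Rightarrow> bool) \<Rightarrow> int mat" where
  "Pmat N prox = mat N N (\<lambda>(i, j). if i = j then 1 else if prox i j then -1 else 0)"

definition inv_mat :: "nat \<Rightarrow> int mat \<Rightarrow> int mat" where
  "inv_mat n A = (SOME B. B \<in> carrier_mat n n \<and> A * B = 1\<^sub>m n \<and> B * A = 1\<^sub>m n)"

definition Qmat :: "nat \<Rightarrow> (nat \<Rightarrow> nat \<Rightarrow> bool) \<Rightarrow> int mat" where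
  "Qmat N prox = inv_mat N (Pmat N prox)"

definition Vmat :: "nat \<Rightarrow> (nat \<Rightarrow> nat \<Rightarrow> bool) \<Rightarrow> int mat" where
  "Vmat N prox = inv_mat N (transpose_mat (Pmat N prox) * Pmat N prox)"

definition dcoef :: "nat \<Rightarrow> (nat \<Rightarrow> nat \<Rightarrow> bool) \<Rightarrow> (nat \<Rightarrow> nat) \<Rightarrow> nat \<Rightarrow> int" where
  "dcoef N prox dhat nu = (\<Sum>i<N. int (dhat i) * Vmat N prox $$ (i, nu))"

text \<open>Coefficients of the canonical divisor: k_nu = sum_mu q_(nu,mu).\<close>
definition kcoef :: "nat \<Rightarrow> (nat \<Rightarrow> nat \<Rightarrow> bool) \<Rightarrow> nat \<Rightarrow> int" where
  "kcoef N prox nu = (\<Sum>mu<N. Qmat N prox $$ (nu, mu))"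

text \<open>F = sum f_nu E_nu is antinef iff fhat = f V^{-1} = f (P^T P) is nonnegative.\<close>
definition antinef :: "nat \<Rightarrow> (nat \<Rightarrow> nat \<Rightarrow> bool) \<Rightarrow> (nat \<Rightarrow> int) \<Rightarrow> bool" where
  "antinef N prox f \<longleftrightarrow>
     (\<forall>nu<N. (\<Sum>mu<N. f mu * (transpose_mat (Pmat N prox) * Pmat N prox) $$ (mu, nu)) \<ge> 0)"

definition lam :: "nat \<Rightarrow> (nat \<Rightarrow> nat \<Rightarrow> bool) \<Rightarrow> (nat \<Rightarrow> nat) \<Rightarrow> (nat \<Rightarrow> int) \<Rightarrow> nat \<Rightarrow> rat" where
  "lam N prox dhat f nu =
     (of_int (f nu) + of_int (kcoef N prox nu) + 1) / of_int (dcoef N prox dhat nu)"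

definition xiF :: "nat \<Rightarrow> (nat \<Rightarrow> nat \<Rightarrow> bool) \<Rightarrow> (nat \<Rightarrow> nat) \<Rightarrow> (nat \<Rightarrow> int) \<Rightarrow> rat" where
  "xiF N prox dhat f = Min ((\<lambda>nu. lam N prox dhat f nu) ` {..<N})"

definition Hset :: "nat \<Rightarrow> (nat \<Rightarrow> nat \<Rightarrow> bool) \<Rightarrow> (nat \<Rightarrow> nat) \<Rightarrow> nat \<Rightarrow> rat set" where
  "Hset N prox dhat mu =
     {xiF N prox dhat f | f. antinef N prox f \<and> xiF N prox dhat f = lam N prox dhat f mu}"

text \<open>Dual graph: E_g and E_e (g < e) meet on X iff x_e is proximate to x_g and no
  later point was blown up at their intersection, i.e. no rho proximate to both.\<close>
definition adj :: "nat \<Rightarrow> (nat \<Rightarrow> nat \<Rightarrow> bool) \<Rightarrow> nat \<Rightarrow> nat \<Rightarrow> bool" where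
  "adj N prox a b \<longleftrightarrow> a < N \<and> b < N \<and> a \<noteq> b \<and>
     prox (max a b) (min a b) \<and> \<not> (\<exists>rho<N. prox rho (min a b) \<and> prox rho (max a b))"

definition valence :: "nat \<Rightarrow> (nat \<Rightarrow> nat \<Rightarrow> bool) \<Rightarrow> nat \<Rightarrow> nat" where
  "valence N prox mu = card {eta. adj N prox mu eta}"

definition branch :: "nat \<Rightarrow> (nat \<Rightarrow> nat \<Rightarrow> bool) \<Rightarrow> nat \<Rightarrow> nat \<Rightarrow> nat set" where
  "branch N prox mu nu =
     (if nu = mu \<or> \<not> nu < N then {}
      else {i. (\<lambda>a b. adj N prox a b \<and> a \<noteq> mu \<and> b \<noteq> mu)\<^sup>*\<^sup>* nu i})"

inductive_set gen_monoid :: "nat set \<Rightarrow> nat set" for A where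
  zero: "0 \<in> gen_monoid A"
| add: "a \<in> A \<Longrightarrow> x \<in> gen_monoid A \<Longrightarrow> a + x \<in> gen_monoid A"

definition SV :: "nat \<Rightarrow> (nat \<Rightarrow> nat \<Rightarrow> bool) \<Rightarrow> nat \<Rightarrow> nat \<Rightarrow> nat set" where
  "SV N prox mu nu =
     gen_monoid ((\<lambda>i. nat (Vmat N prox $$ (mu, i))) ` (branch N prox mu nu \<union> {mu}))"

definition sgcd :: "nat \<Rightarrow> (nat \<Rightarrow> nat \<Rightarrow> bool) \<Rightarrow> nat \<Rightarrow> nat \<Rightarrow> nat" where
  "sgcd N prox mu nu = Gcd (SV N prox mu nu)"

definition Smon :: "nat \<Rightarrow> (nat \<Rightarrow> nat \<Rightarrow> bool) \<Rightarrow> nat \<Rightarrow> nat set" where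
  "Smon N prox mu = gen_monoid ((\<lambda>nu. sgcd N prox mu nu) ` {..<N})"

definition ceil_pos :: "rat \<Rightarrow> int" where
  "ceil_pos x = max 1 \<lceil>x\<rceil>"

definition hfun :: "nat \<Rightarrow> (nat \<Rightarrow> nat \<Rightarrow> bool) \<Rightarrow> (nat \<Rightarrow> nat) \<Rightarrow> nat \<Rightarrow> rat \<Rightarrow> rat" where
  "hfun N prox dhat mu xi =
     of_int (dcoef N prox dhat mu) * xi
     + (of_nat (valence N prox mu) - 2) * of_int (Vmat N prox $$ (mu, mu))
     - (\<Sum>nu\<in>{nu. adj N prox mu nu}. of_nat (sgcd N prox mu nu) *
          of_int (ceil_pos ((\<Sum>i\<in>branch N prox mu nu.
               of_nat (dhat i) * of_int (Vmat N prox $$ (mu, i)) / of_nat (sgcd N prox mu nu)) * xi)))"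

definition hfun2 :: "nat \<Rightarrow> (nat \<Rightarrow> nat \<Rightarrow> bool) \<Rightarrow> (nat \<Rightarrow> nat) \<Rightarrow> nat \<Rightarrow> rat \<Rightarrow> rat" where
  "hfun2 N prox dhat mu t =
     t + (of_nat (valence N prox mu) - 2) * of_int (Vmat N prox $$ (mu, mu))
     - (\<Sum>nu\<in>{nu. adj N prox mu nu}. of_nat (sgcd N prox mu nu) *
          of_int (ceil_pos (t * (\<Sum>i\<in>branch N prox mu nu.
               of_nat (dhat i) * of_int (Vmat N prox $$ (mu, i))
                 / (of_nat (sgcd N prox mu nu) * of_int (dcoef N prox dhat mu))))))"

end

theory Submission
  imports Defs "Jordan_Normal_Form.Determinant"
begin

text \<open>
  Put \<open>A = P\<^sup>T P\<close>, so \<open>V = A\<^sup>-\<^sup>1\<close>, and write \<open>v\<close> for the valence vector. Adjunction reads \<open>A (k + 1) = 2 - v\<close>. With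
  \<open>w = f + k + 1\<close>, the number \<open>\<xi>\<close> is a jumping number supported at \<open>\<mu>\<close> iff some integer vector \<open>w\<close>
  satisfies \<open>A w \<ge> 2 - v\<close>, \<open>w \<ge> \<xi> d\<close> and \<open>w\<^sub>\<mu> = \<xi> d\<^sub>\<mu>\<close>. Once \<open>w\<^sub>\<mu>\<close> is fixed, the branches at \<open>\<mu>\<close> interact only
  through the inequality at \<open>\<mu>\<close>, which involves just the values \<open>w\<^sub>\<nu>\<close> at the neighbours \<open>\<nu>\<close>, or
  equivalently the integers \<open>u\<^sub>\<nu> = (V\<^bsub>\<mu>\<mu>\<^esub> w\<^sub>\<nu> - V\<^bsub>\<nu>\<mu>\<^esub> w\<^sub>\<mu>) / s\<^sub>\<nu>\<close>.

  A value \<open>w\<^sub>\<nu>\<close> extends to the whole branch iff \<open>u\<^sub>\<nu>\<close> is at least the rounded-up positive integer in the formula for \<open>h\<close>.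
  For sufficiency one extends greedily outwards from \<open>\<mu>\<close>. For necessity, \<open>u\<^sub>\<nu> = 0\<close> would propagate to
  a leaf of the branch, because \<open>V\<^bsub>\<nu>\<nu>\<^esub>\<close> divides \<open>V\<^bsub>j\<nu>\<^esub> V\<^bsub>k\<nu>\<^esub>\<close> for distinct neighbours \<open>j, k\<close> of \<open>\<nu>\<close>. Finally
  \<open>h\<close> equals \<open>V\<^bsub>\<mu>\<mu>\<^esub>\<close> times the slack at \<open>\<mu>\<close> plus the \<open>s\<^sub>\<nu>\<close>-multiples of the excesses of the
  \<open>u\<^sub>\<nu>\<close>, and the same divisibilities make every such decomposition come from integral \<open>w\<^sub>\<nu>\<close>.
\<close>

section \<open>Integer matrices of determinant one, edge counts, integer rounding and generated
  monoids\<close>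

text \<open>For determinant 1 the adjugate is an integral two-sided inverse, so the choice in
  \<open>inv_mat\<close> does pick an inverse.\<close>

lemma inv_mat_works:
  assumes "A \<in> carrier_mat n n" "det A = 1"
  shows "inv_mat n A \<in> carrier_mat n n" "A * inv_mat n A = 1\<^sub>m n" "inv_mat n A * A = 1\<^sub>m n"
proof -
  have one: "(1::int) \<cdot>\<^sub>m 1\<^sub>m n = 1\<^sub>m n"
    by (rule eq_matI) auto
  have "\<exists>B. B \<in> carrier_mat n n \<and> A * B = 1\<^sub>m n \<and> B * A = 1\<^sub>m n"
    using adj_mat[OF assms(1)] assms(2) one by auto
  from someI_ex[OF this]
  show "inv_mat n A \<in> carrier_mat n n" "A * inv_mat n A = 1\<^sub>m n" "inv_mat n A * A = 1\<^sub>m n"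
    unfolding inv_mat_def by auto
qed

lemma mat_mult_entry:
  assumes "A \<in> carrier_mat n n" "B \<in> carrier_mat n n" "i < n" "j < n"
  shows "(A * B) $$ (i, j) = (\<Sum>r<n. A $$ (i, r) * B $$ (r, j))"
  using assms by (auto simp: scalar_prod_def atLeast0LessThan intro!: sum.cong)

text \<open>Each vertex other than \<open>r\<close> chooses a predecessor at smaller distance from
  \<open>r\<close>. As the distance drops along every chosen edge, these edges and their reversals
  are all distinct.\<close>

lemma symmetric_connected_card:
  fixes R :: "('a \<times> 'a) set"
  assumes "finite S" "finite R" "sym R" "r \<in> S"
    and reach: "\<And>v. v \<in> S \<Longrightarrow> (r, v) \<in> R\<^sup>*"
  shows "2 * (card S - 1) \<le> card R"
proof -
  define dist where "dist v = (LEAST n. (r, v) \<in> R ^^ n)" for v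
  have dist: "(r, v) \<in> R ^^ dist v" if "v \<in> S" for v
    unfolding dist_def using rtrancl_imp_relpow[OF reach[OF that]] by (metis LeastI_ex)
  have "\<exists>p. (p, v) \<in> R \<and> dist p < dist v" if "v \<in> S - {r}" for v
  proof -
    have "dist v \<noteq> 0" using dist[of v] that by (metis DiffE insertI1 relpow_0_E)
    then obtain n where n: "dist v = Suc n" by (cases "dist v") auto
    with dist[of v] that have "(r, v) \<in> R ^^ Suc n" by simp
    then obtain p where p: "(r, p) \<in> R ^^ n" "(p, v) \<in> R" by auto
    have "dist p \<le> n" unfolding dist_def using p(1) by (rule Least_le)
    then show ?thesis using p n by auto
  qed
  then obtain p where p: "\<And>v. v \<in> S - {r} \<Longrightarrow> (p v, v) \<in> R \<and> dist (p v) < dist v"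
    by metis
  let ?X = "(\<lambda>v. (p v, v)) ` (S - {r})" and ?Y = "(\<lambda>v. (v, p v)) ` (S - {r})"
  have disj: "?X \<inter> ?Y = {}"
  proof (rule equals0I)
    fix e assume "e \<in> ?X \<inter> ?Y"
    then obtain u v where "u \<in> S - {r}" "v \<in> S - {r}" "p u = v" "u = p v" by blast
    then show False using p[of u] p[of v] by auto
  qed
  have sub: "?X \<union> ?Y \<subseteq> R" using p \<open>sym R\<close> by (auto dest: symD)
  have "card ?X = card S - 1" "card ?Y = card S - 1"
    using assms(1,4) by (auto simp: card_image inj_on_def)
  then have "card (?X \<union> ?Y) = 2 * (card S - 1)"
    using disj assms(1) by (subst card_Un_disjoint) auto
  then show ?thesis using card_mono[OF assms(2) sub] by simp
qed

text \<open>The \<open>c\<close> meant is the least one with \<open>v * c - a\<close> positive and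
  at least \<open>\<tau>\<close>. Leastness is stored as an upper bound on
  \<open>v * (c - 1)\<close>. For \<open>\<tau> = 0\<close> this bound need not be strict, since
  \<open>v\<close> may divide \<open>a\<close>.\<close>

lemma least_int_above:
  fixes v a :: int and \<tau> :: rat
  assumes "v > 0" "\<tau> \<ge> 0"
  shows "\<exists>c. a < v * c \<and> \<tau> \<le> of_int (v * c - a) \<and> of_int (v * (c - 1)) \<le> of_int a + \<tau> \<and>
    (\<tau> > 0 \<longrightarrow> of_int (v * (c - 1)) < of_int a + \<tau>)"
proof (cases "\<tau> > 0")
  case True
  define x where "x = (of_int a + \<tau>) / of_int v"
  have v: "of_int v * x = of_int a + \<tau>" "(0::rat) < of_int v" using assms by (auto simp: x_def)
  have "of_int v * x \<le> of_int v * of_int \<lceil>x\<rceil>" using v(2) by (intro mult_left_mono) auto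
  moreover have "of_int v * (of_int \<lceil>x\<rceil> - 1) < of_int v * x"
    using v(2) by (intro mult_strict_left_mono) linarith+
  ultimately have "of_int a + \<tau> \<le> of_int (v * \<lceil>x\<rceil>)" "of_int (v * (\<lceil>x\<rceil> - 1)) < of_int a + \<tau>"
    using v(1) by auto
  moreover from this(1) True have "of_int a < (of_int (v * \<lceil>x\<rceil>) :: rat)" by linarith
  then have "a < v * \<lceil>x\<rceil>" by (simp only: of_int_less_iff)
  ultimately show ?thesis by (intro exI[of _ "\<lceil>x\<rceil>"]) auto
next
  case False
  then have "\<tau> = 0" using assms by simp
  moreover have "v * (a div v) \<le> a" "a < v * (a div v + 1)"
    using assms by (simp_all add: zdiv_mono1 algebra_simps) (smt (verit) mult_div_mod_eq pos_mod_bound pos_mod_sign)+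
  ultimately show ?thesis
    by (intro exI[of _ "a div v + 1"]) (simp flip: of_int_mult of_int_add of_int_diff)
qed

lemma gen_monoid_base: "a \<in> G \<Longrightarrow> a \<in> gen_monoid G"
  using gen_monoid.add[OF _ gen_monoid.zero, of a G] by simp

lemma gen_monoid_plus: "x \<in> gen_monoid G \<Longrightarrow> y \<in> gen_monoid G \<Longrightarrow> x + y \<in> gen_monoid G"
  by (induction rule: gen_monoid.induct) (auto simp: add.assoc intro: gen_monoid.add)

lemma gen_monoid_mult: "x \<in> gen_monoid G \<Longrightarrow> c * x \<in> gen_monoid G"
  by (induction c) (auto intro: gen_monoid.zero gen_monoid_plus)

lemma gen_monoid_sum:
  "(\<And>i. i \<in> I \<Longrightarrow> f i \<in> gen_monoid G) \<Longrightarrow> (\<Sum>i\<in>I. f i) \<in> gen_monoid G"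
  by (induction I rule: infinite_finite_induct) (auto intro: gen_monoid.zero gen_monoid_plus)

lemma Gcd_gen_monoid: "Gcd (gen_monoid G) = Gcd G"
proof (rule dvd_antisym)
  show "Gcd (gen_monoid G) dvd Gcd G"
    by (meson Gcd_dvd Gcd_greatest gen_monoid_base)
  show "Gcd G dvd Gcd (gen_monoid G)"
  proof (rule Gcd_greatest)
    fix x assume "x \<in> gen_monoid G"
    then show "Gcd G dvd x" by (induction rule: gen_monoid.induct) auto
  qed
qed

section \<open>The intersection form\<close>

locale proximity =
  fixes N :: nat and prox :: "nat \<Rightarrow> nat \<Rightarrow> bool"
  assumes valid: "valid_prox N prox"
begin

abbreviation nb where "nb \<equiv> adj N prox"
abbreviation Br where "Br \<equiv> branch N prox"
abbreviation V where "V i j \<equiv> Vmat N prox $$ (i, j)"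
abbreviation Q where "Q i j \<equiv> Qmat N prox $$ (i, j)"
abbreviation val where "val i \<equiv> int (valence N prox i)"

definition p :: "nat \<Rightarrow> nat \<Rightarrow> int" where
  "p i j = (if i = j then 1 else if prox i j then -1 else 0)"

text \<open>Minus the intersection matrix of the \<open>E\<^sub>\<nu>\<close>.\<close>

definition A :: "nat \<Rightarrow> nat \<Rightarrow> int" where
  "A i j = (\<Sum>r<N. p r i * p r j)"

lemma N_pos: "0 < N"
  using valid unfolding valid_prox_def by linarith

lemma prox_less: "prox i j \<Longrightarrow> j < i" and prox_bound: "prox i j \<Longrightarrow> i < N"
  using valid unfolding valid_prox_def by blast+

lemma card_prox: "1 \<le> i \<Longrightarrow> i < N \<Longrightarrow> card {j. prox i j} \<in> {1, 2}"
  using valid unfolding valid_prox_def by blast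

lemma prox_two: "prox m i \<Longrightarrow> prox m j \<Longrightarrow> i < j \<Longrightarrow> prox j i"
  and prox_no_between: "prox m i \<Longrightarrow> prox m j \<Longrightarrow> i < j \<Longrightarrow> j < r \<Longrightarrow> r < m \<Longrightarrow>
    prox r i \<Longrightarrow> prox r j \<Longrightarrow> False"
  using valid unfolding valid_prox_def by blast+

text \<open>Blowing up the point where two exceptional curves meet separates their strict
  transforms, so it can happen only once.\<close>

lemma prox_common_unique:
  assumes "prox m i" "prox m j" "prox r i" "prox r j" "i < j"
  shows "m = r"
  using assms prox_no_between[of m i j r] prox_no_between[of r i j m] prox_less by (metis linorder_neqE_nat)

lemma P_carrier: "Pmat N prox \<in> carrier_mat N N"
  by (simp add: Pmat_def)

lemma P_entry: "i < N \<Longrightarrow> j < N \<Longrightarrow> Pmat N prox $$ (i, j) = p i j"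
  by (simp add: Pmat_def p_def)

lemma det_P: "det (Pmat N prox) = 1"
proof -
  have "det (Pmat N prox) = prod_list (diag_mat (Pmat N prox))"
    by (rule det_lower_triangular[OF _ P_carrier])
      (auto simp: P_entry p_def dest: prox_less)
  also have "diag_mat (Pmat N prox) = map (\<lambda>i. 1) [0..<N]"
    unfolding diag_mat_def using P_carrier by (auto simp: P_entry p_def)
  finally show ?thesis by (simp add: map_replicate_const)
qed

lemma PtP_carrier: "transpose_mat (Pmat N prox) * Pmat N prox \<in> carrier_mat N N"
  using P_carrier by simp

lemma PtP_entry:
  "i < N \<Longrightarrow> j < N \<Longrightarrow> (transpose_mat (Pmat N prox) * Pmat N prox) $$ (i, j) = A i j"
  using P_carrier by (subst mat_mult_entry[of _ N]) (auto simp: A_def P_entry intro!: sum.cong)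

lemma det_PtP: "det (transpose_mat (Pmat N prox) * Pmat N prox) = 1"
  using P_carrier by (subst det_mult[of _ N]) (auto simp: det_transpose[OF P_carrier] det_P)

lemmas Q_inv = inv_mat_works[OF P_carrier det_P, folded Qmat_def]
lemmas V_inv = inv_mat_works[OF PtP_carrier det_PtP, folded Vmat_def]

lemma P_Q: "i < N \<Longrightarrow> j < N \<Longrightarrow> (\<Sum>r<N. p i r * Q r j) = (if i = j then 1 else 0)"
  using mat_mult_entry[OF P_carrier Q_inv(1), of i j] Q_inv(2) by (simp add: P_entry)

lemma A_V: "i < N \<Longrightarrow> j < N \<Longrightarrow> (\<Sum>r<N. A i r * V r j) = (if i = j then 1 else 0)"
  using mat_mult_entry[OF PtP_carrier V_inv(1), of i j] V_inv(2) by (simp add: PtP_entry)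

text \<open>This factorization yields the symmetry of \<open>V\<close> and reduces the positivity of
  its entries to facts about \<open>Q\<close>.\<close>

lemma V_eq_QQt: "Vmat N prox = Qmat N prox * transpose_mat (Qmat N prox)"
proof -
  let ?P = "Pmat N prox" and ?Q = "Qmat N prox"
  let ?Pt = "transpose_mat ?P" and ?Qt = "transpose_mat ?Q"
  have car: "?P \<in> carrier_mat N N" "?Q \<in> carrier_mat N N" "?Pt \<in> carrier_mat N N" "?Qt \<in> carrier_mat N N"
    using P_carrier Q_inv(1) by auto
  have "(?Pt * ?P) * (?Q * ?Qt) = ?Pt * ((?P * ?Q) * ?Qt)"
    using car by (simp add: assoc_mult_mat[of _ N N _ N _ N])
  also have "\<dots> = ?Pt * ?Qt" using car Q_inv(2) by simp
  also have "\<dots> = transpose_mat (?Q * ?P)" using car by (simp add: transpose_mult[of _ N N _ N])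
  also have "\<dots> = 1\<^sub>m N" using Q_inv(3) by simp
  finally have inv: "(?Pt * ?P) * (?Q * ?Qt) = 1\<^sub>m N" .
  have "Vmat N prox = Vmat N prox * ((?Pt * ?P) * (?Q * ?Qt))"
    using inv V_inv(1) by simp
  also have "\<dots> = (Vmat N prox * (?Pt * ?P)) * (?Q * ?Qt)"
    using V_inv(1) PtP_carrier car by (intro assoc_mult_mat[symmetric]) auto
  also have "\<dots> = ?Q * ?Qt" using V_inv(3) car by simp
  finally show ?thesis .
qed

lemma V_entry: "i < N \<Longrightarrow> j < N \<Longrightarrow> V i j = (\<Sum>r<N. Q i r * Q j r)"
  unfolding V_eq_QQt using Q_inv(1) by (subst mat_mult_entry[of _ N]) auto

lemma V_sym: "i < N \<Longrightarrow> j < N \<Longrightarrow> V i j = V j i"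
  by (simp add: V_entry mult.commute)

lemma A_sym: "A i j = A j i"
  by (simp add: A_def mult.commute)

lemma finite_prox: "finite {j. prox i j}"
  by (rule finite_subset[of _ "{..<i}"]) (auto dest: prox_less)

lemma p_row:
  assumes "i < N"
  shows "(\<Sum>r<N. p i r * x r) = x i - (\<Sum>r | prox i r. x r)"
proof -
  have "(\<Sum>r<N. p i r * x r) = (\<Sum>r<N. (if r = i then x i else 0) - (if prox i r then x r else 0))"
    by (rule sum.cong) (auto simp: p_def dest: prox_less)
  also have "\<dots> = x i - (\<Sum>r<N. if prox i r then x r else 0)"
    using assms by (simp add: sum_subtractf)
  also have "(\<Sum>r<N. if prox i r then x r else 0) = (\<Sum>r | prox i r. x r)"
    by (rule sum.mono_neutral_cong_right) (use assms in \<open>auto dest: prox_less\<close>)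
  finally show ?thesis .
qed

lemma Q_rec:
  assumes "i < N" "j < N"
  shows "Q i j = (if i = j then 1 else 0) + (\<Sum>r | prox i r. Q r j)"
  using P_Q[OF assms] p_row[OF assms(1), of "\<lambda>r. Q r j"] by simp

lemma Q_nonneg: "i < N \<Longrightarrow> j < N \<Longrightarrow> 0 \<le> Q i j"
proof (induction i rule: less_induct)
  case (less i)
  have "0 \<le> (\<Sum>r | prox i r. Q r j)"
  proof (rule sum_nonneg)
    fix r assume "r \<in> {r. prox i r}"
    then have "r < i" using prox_less by blast
    then show "0 \<le> Q r j" using less.IH[of r] less.prems by simp
  qed
  then show ?case using Q_rec[OF less.prems] by auto
qed

text \<open>Every vertex other than 0 is proximate to an earlier one, so \<open>Q_rec\<close>
  carries positivity upwards from vertex 0. Column 0 supplies the positive term in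
  \<open>V_pos\<close>.\<close>

lemma Q_zero_pos: "i < N \<Longrightarrow> 0 < Q i 0"
proof (induction i rule: less_induct)
  case (less i)
  show ?case
  proof (cases "i = 0")
    case True
    moreover have "Collect (prox 0) = {}" by (auto dest: prox_less)
    ultimately show ?thesis using Q_rec[of 0 0] N_pos by simp
  next
    case False
    then obtain j where j: "prox i j" using card_prox[of i] less.prems
      by (metis One_nat_def Suc_leI card.empty empty_Collect_eq empty_iff insert_iff neq0_conv zero_neq_numeral zero_neq_one)
    have "j < i" using j prox_less by blast
    then have "0 < Q j 0" using less.IH[of j] less.prems by simp
    moreover have "Q j 0 \<le> (\<Sum>r | prox i r. Q r 0)"
      using finite_prox j less.prems prox_less N_pos
      by (intro member_le_sum) (auto intro!: Q_nonneg intro: less_trans)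
    ultimately show ?thesis using Q_rec[of i 0] False less.prems N_pos by simp
  qed
qed

lemma V_pos:
  assumes "i < N" "j < N"
  shows "0 < V i j"
proof -
  have "0 < Q i 0 * Q j 0" using Q_zero_pos assms by simp
  also have "\<dots> \<le> (\<Sum>r<N. Q i r * Q j r)"
    using assms N_pos Q_nonneg by (intro member_le_sum[of 0 "{..<N}" "\<lambda>r. Q i r * Q j r"]) auto
  finally show ?thesis using V_entry assms by simp
qed

lemma nb_sym: "nb i j \<Longrightarrow> nb j i"
  by (simp add: adj_def max.commute min.commute)

lemma nb_less: "nb i j \<Longrightarrow> i < N" "nb i j \<Longrightarrow> j < N" and nb_irrefl: "\<not> nb i i"
  by (simp_all add: adj_def)

lemma finite_nb: "finite {j. nb i j}"
  by (rule finite_subset[of _ "{..<N}"]) (auto dest: nb_less)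

text \<open>Besides row \<open>j\<close>, only points proximate to both \<open>i\<close> and
  \<open>j\<close> contribute. There is at most one such point, and its 1 cancels the -1 that comes
  from the proximity of \<open>j\<close> to \<open>i\<close>.\<close>

lemma A_offdiag_less:
  assumes "i < j" "j < N"
  shows "A i j = (if nb i j then -1 else 0)"
proof -
  let ?S = "{r. prox r i \<and> prox r j}"
  have sub: "?S \<subseteq> {..<N}" by (auto dest: prox_bound)
  have "A i j = (\<Sum>r<N. (if r = j then p j i else 0) + (if r \<in> ?S then 1 else 0))"
    unfolding A_def using assms prox_less
    by (intro sum.cong) (auto simp: p_def dest: less_asym)
  also have "\<dots> = p j i + (\<Sum>r<N. if r \<in> ?S then 1 else 0)"
    using assms by (simp add: sum.distrib)
  also have "(\<Sum>r<N. if r \<in> ?S then 1 else (0::int)) = card ?S"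
    using sub by (simp add: sum.If_cases Int_absorb1)
  finally have A: "A i j = p j i + card ?S" .
  show ?thesis
  proof (cases "?S = {}")
    case True
    then have "card ?S = 0" by (metis card.empty)
    moreover have "nb i j \<longleftrightarrow> prox j i" using True assms by (auto simp: adj_def)
    ultimately show ?thesis using A assms by (simp add: p_def)
  next
    case False
    then obtain r where r: "prox r i" "prox r j" by auto
    then have "?S = {r}" using prox_common_unique assms by blast
    then have "card ?S = 1" by simp
    moreover have "prox j i" using r prox_two assms by blast
    moreover have "\<not> nb i j" using r assms prox_bound by (auto simp: adj_def)
    ultimately show ?thesis using A assms by (simp add: p_def)
  qed
qed

lemma A_offdiag: "i \<noteq> j \<Longrightarrow> i < N \<Longrightarrow> j < N \<Longrightarrow> A i j = (if nb i j then -1 else 0)"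
  by (metis A_offdiag_less A_sym linorder_neqE_nat nb_sym)

lemma A_row:
  assumes "i < N"
  shows "(\<Sum>j<N. A i j * x j) = A i i * x i - (\<Sum>j | nb i j. x j)"
proof -
  have "(\<Sum>j<N. A i j * x j) = (\<Sum>j<N. (if j = i then A i i * x i else 0) - (if nb i j then x j else 0))"
    using assms by (intro sum.cong) (auto simp: A_offdiag nb_irrefl)
  also have "\<dots> = A i i * x i - (\<Sum>j<N. if nb i j then x j else 0)"
    using assms by (simp add: sum_subtractf)
  also have "(\<Sum>j<N. if nb i j then x j else 0) = (\<Sum>j | nb i j. x j)"
    by (rule sum.mono_neutral_cong_right) (auto dest: nb_less)
  finally show ?thesis .
qed

text \<open>The quadratic form is the squared length of \<open>P x\<close>, and
  \<open>P x = 0\<close> forces \<open>x = 0\<close> recursively because \<open>P\<close> is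
  unitriangular.\<close>

lemma A_pos_def:
  assumes "(\<Sum>i<N. x i * (\<Sum>j<N. A i j * x j)) = 0" "i < N"
  shows "x i = 0"
proof -
  have "(\<Sum>i<N. x i * (\<Sum>j<N. A i j * x j)) = (\<Sum>i<N. \<Sum>j<N. \<Sum>r<N. (p r i * x i) * (p r j * x j))"
    by (simp add: A_def sum_distrib_left sum_distrib_right algebra_simps)
  also have "\<dots> = (\<Sum>i<N. \<Sum>r<N. \<Sum>j<N. (p r i * x i) * (p r j * x j))"
    by (rule sum.cong[OF refl], rule sum.swap)
  also have "\<dots> = (\<Sum>r<N. \<Sum>i<N. \<Sum>j<N. (p r i * x i) * (p r j * x j))"
    by (rule sum.swap)
  also have "\<dots> = (\<Sum>r<N. (\<Sum>i<N. p r i * x i)\<^sup>2)"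
    by (simp add: power2_eq_square sum_product)
  finally have "(\<Sum>r<N. (\<Sum>i<N. p r i * x i)\<^sup>2) = 0" using assms by simp
  then have z: "(\<Sum>i<N. p r i * x i) = 0" if "r < N" for r
    using that by (subst (asm) sum_nonneg_eq_0_iff) auto
  show ?thesis using assms(2)
  proof (induction i rule: less_induct)
    case (less i)
    have "(\<Sum>r | prox i r. x r) = 0"
      using less prox_less by (intro sum.neutral) (auto intro: less_trans)
    then show ?case using z[of i] p_row[of i x] less by simp
  qed
qed

text \<open>Uniqueness for a Dirichlet problem on \<open>B\<close>: as \<open>A\<close> couples only
  neighbours, setting \<open>x\<close> to zero outside \<open>B\<close> does not change
  \<open>A x\<close> on \<open>B\<close>, and \<open>A_pos_def\<close> applies to the truncated
  vector.\<close>

lemma A_closed_kernel: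
  assumes B: "B \<subseteq> {..<N}"
    and ker: "\<And>i. i \<in> B \<Longrightarrow> (\<Sum>j<N. A i j * x j) = 0"
    and bd: "\<And>i j. i \<in> B \<Longrightarrow> nb i j \<Longrightarrow> j \<notin> B \<Longrightarrow> x j = 0"
    and i: "i \<in> B"
  shows "x i = 0"
proof -
  define y where "y j = (if j \<in> B then x j else 0)" for j
  have "(\<Sum>k<N. A j k * y k) = (\<Sum>k<N. A j k * x k)" if "j \<in> B" for j
  proof (intro sum.cong refl)
    fix k assume k: "k \<in> {..<N}"
    show "A j k * y k = A j k * x k"
    proof (cases "k \<in> B \<or> nb j k")
      case True
      then show ?thesis using bd that by (auto simp: y_def)
    next
      case False
      then have "A j k = 0" using A_offdiag[of j k] that B k by auto
      then show ?thesis by simp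
    qed
  qed
  then have "(\<Sum>j<N. y j * (\<Sum>k<N. A j k * y k)) = 0"
    using ker by (intro sum.neutral) (auto simp: y_def)
  from A_pos_def[OF this, of i] show ?thesis using i B by (auto simp: y_def)
qed

lemma val_eq: "(\<Sum>j<N. A i j) = A i i - val i" if "i < N"
  using A_row[OF that, of "\<lambda>_. 1"] by (simp add: valence_def)

text \<open>Since \<open>k = Q 1\<close>, the vector \<open>A k\<close> consists of the column sums
  of \<open>P\<close>. Off-diagonal entries satisfy \<open>p * p + p = 0\<close> and the diagonal
  entry gives 2, so column \<open>i\<close> sums to \<open>2 - A i i\<close>.\<close>

lemma k_adjunction:
  assumes "i < N"
  shows "(\<Sum>j<N. A i j * (kcoef N prox j + 1)) = 2 - val i"
proof -
  have "(\<Sum>j<N. A i j * kcoef N prox j) = (\<Sum>j<N. \<Sum>r<N. p r i * (p r j * kcoef N prox j))"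
    by (simp add: A_def sum_distrib_right mult.assoc)
  also have "\<dots> = (\<Sum>r<N. \<Sum>j<N. p r i * (p r j * kcoef N prox j))" by (rule sum.swap)
  also have "\<dots> = (\<Sum>r<N. p r i * (\<Sum>j<N. p r j * kcoef N prox j))" by (simp add: sum_distrib_left)
  also have "\<dots> = (\<Sum>r<N. p r i)"
  proof (intro sum.cong refl)
    fix r assume r: "r \<in> {..<N}"
    have "(\<Sum>j<N. p r j * kcoef N prox j) = (\<Sum>j<N. \<Sum>m<N. p r j * Q j m)"
      by (simp add: kcoef_def sum_distrib_left)
    also have "\<dots> = (\<Sum>m<N. \<Sum>j<N. p r j * Q j m)" by (rule sum.swap)
    also have "\<dots> = (\<Sum>m<N. if r = m then 1 else 0)" using r by (intro sum.cong) (auto simp: P_Q)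
    also have "\<dots> = 1" using r by simp
    finally show "p r i * (\<Sum>j<N. p r j * kcoef N prox j) = p r i" by simp
  qed
  finally have k: "(\<Sum>j<N. A i j * kcoef N prox j) = (\<Sum>r<N. p r i)" .
  have "A i i + (\<Sum>r<N. p r i) = (\<Sum>r<N. p r i * p r i + p r i)" by (simp add: A_def sum.distrib)
  also have "\<dots> = (\<Sum>r<N. if r = i then 2 else 0)" by (intro sum.cong) (auto simp: p_def)
  also have "\<dots> = 2" using assms by simp
  finally show ?thesis using k val_eq[OF assms] by (simp add: distrib_left sum.distrib)
qed

text \<open>The sum of all entries of \<open>A\<close> is \<open>|P 1|\<^sup>2\<close> and its trace is \<open>|P|\<^sup>2\<close>; both are read off from the
  rows of \<open>P\<close>, which contain one or two entries \<open>-1\<close> (none in row 0).\<close>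

lemma sum_val: "(\<Sum>i<N. val i) = 2 * int N - 2"
proof -
  define c where "c i = int (card {j. prox i j})" for i
  have row: "(\<Sum>j<N. p i j) = 1 - c i" "(\<Sum>j<N. p i j * p i j) = 1 + c i" if i: "i < N" for i
  proof -
    show "(\<Sum>j<N. p i j) = 1 - c i" using p_row[OF i, of "\<lambda>_. 1"] by (simp add: c_def)
    have "(\<Sum>j<N. p i j * p i j) = p i i - (\<Sum>r | prox i r. p i r)" by (rule p_row[OF i])
    also have "(\<Sum>r | prox i r. p i r) = (\<Sum>r | prox i r. -1)"
      by (rule sum.cong) (auto simp: p_def dest: prox_less)
    finally show "(\<Sum>j<N. p i j * p i j) = 1 + c i" by (simp add: c_def p_def)
  qed
  have "(\<Sum>i<N. \<Sum>j<N. A i j) = (\<Sum>i<N. \<Sum>r<N. \<Sum>j<N. p r i * p r j)"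
    unfolding A_def by (rule sum.cong[OF refl], rule sum.swap)
  also have "\<dots> = (\<Sum>r<N. \<Sum>i<N. \<Sum>j<N. p r i * p r j)" by (rule sum.swap)
  also have "\<dots> = (\<Sum>r<N. (1 - c r) * (1 - c r))"
    by (rule sum.cong) (simp_all add: row flip: sum_product)
  finally have tot: "(\<Sum>i<N. \<Sum>j<N. A i j) = (\<Sum>r<N. (1 - c r) * (1 - c r))" .
  have "(\<Sum>i<N. A i i) = (\<Sum>r<N. \<Sum>i<N. p r i * p r i)" unfolding A_def by (rule sum.swap)
  also have "\<dots> = (\<Sum>r<N. 1 + c r)" by (rule sum.cong) (simp_all add: row)
  finally have tr: "(\<Sum>i<N. A i i) = (\<Sum>r<N. 1 + c r)" .
  have "(\<Sum>i<N. val i) = (\<Sum>i<N. A i i - (\<Sum>j<N. A i j))"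
    by (rule sum.cong) (simp_all add: val_eq)
  also have "\<dots> = (\<Sum>r<N. 1 + c r) - (\<Sum>r<N. (1 - c r) * (1 - c r))"
    using tot tr by (simp add: sum_subtractf)
  also have "\<dots> = (\<Sum>r<N. 1 + c r - (1 - c r) * (1 - c r))" by (simp add: sum_subtractf)
  \<comment> \<open>With \<open>c\<close> entries -1 a row contributes \<open>3 * c - c * c\<close>,
    which is 2 for \<open>c = 1\<close> and \<open>c = 2\<close> alike.\<close>
  also have "\<dots> = (\<Sum>r<N. if r = 0 then 0 else 2)"
  proof (rule sum.cong[OF refl])
    fix r assume r: "r \<in> {..<N}"
    show "1 + c r - (1 - c r) * (1 - c r) = (if r = 0 then 0 else 2)"
    proof (cases "r = 0")
      case True
      then have "{j. prox r j} = {}" by (auto dest: prox_less)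
      then have "c r = 0" by (simp add: c_def)
      then show ?thesis using True by simp
    next
      case False
      then have "c r = 1 \<or> c r = 2" using card_prox[of r] r by (auto simp: c_def)
      then show ?thesis using False by auto
    qed
  qed
  also have "\<dots> = 2 * int N - 2"
    using N_pos by (simp add: sum.If_cases lessThan_def[symmetric] Diff_eq[symmetric] of_nat_diff flip: set_diff_eq)
  finally show ?thesis .
qed

section \<open>The dual tree\<close>

lemma Br_iff:
  "i \<in> Br m n \<longleftrightarrow> n \<noteq> m \<and> n < N \<and> (\<lambda>a b. nb a b \<and> a \<noteq> m \<and> b \<noteq> m)\<^sup>*\<^sup>* n i"
  by (auto simp: branch_def)

lemma Br_self: "nb m n \<Longrightarrow> n \<in> Br m n"
  using nb_less nb_irrefl by (auto simp: Br_iff)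

lemma Br_closed: "i \<in> Br m n \<Longrightarrow> i \<noteq> m \<Longrightarrow> nb i j \<Longrightarrow> j \<noteq> m \<Longrightarrow> j \<in> Br m n"
  unfolding Br_iff by (auto intro: rtranclp.rtrancl_into_rtrancl)

lemma Br_induct [consumes 1, case_names base step]:
  assumes "i \<in> Br m n"
    and "P n"
    and "\<And>i j. i \<in> Br m n \<Longrightarrow> i \<noteq> m \<Longrightarrow> P i \<Longrightarrow> nb i j \<Longrightarrow> j \<noteq> m \<Longrightarrow> P j"
  shows "P i"
proof -
  have "(\<lambda>a b. nb a b \<and> a \<noteq> m \<and> b \<noteq> m)\<^sup>*\<^sup>* n i" using assms(1) by (simp add: Br_iff)
  then show ?thesis
  proof (induction rule: rtranclp_induct)
    case base
    then show ?case using assms(2) .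
  next
    case (step y z)
    then show ?case using assms(1,3) by (auto simp: Br_iff)
  qed
qed

lemma Br_less: "i < N" if "i \<in> Br m n"
  using that by (rule Br_induct) (use that in \<open>auto simp: Br_iff dest: nb_less\<close>)

lemma Br_center: "i \<noteq> m" if "i \<in> Br m n"
  using that by (rule Br_induct) (use that in \<open>auto simp: Br_iff\<close>)

lemma finite_Br: "finite (Br m n)"
  by (rule finite_subset[of _ "{..<N}"]) (auto dest: Br_less)

text \<open>Branches are components of the graph without \<open>m\<close>, so any vertex of a branch
  can serve as its base point.\<close>

lemma Br_eq:
  assumes "i \<in> Br m n"
  shows "Br m i = Br m n"
proof -
  let ?R = "\<lambda>a b. nb a b \<and> a \<noteq> m \<and> b \<noteq> m"
  have "symp ?R" by (auto simp: symp_def nb_sym)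
  then have "symp ?R\<^sup>*\<^sup>*" by (rule symp_rtranclp)
  moreover have "?R\<^sup>*\<^sup>* n i" using assms by (simp add: Br_iff)
  ultimately have "?R\<^sup>*\<^sup>* i = ?R\<^sup>*\<^sup>* n"
    by (intro ext) (meson rtranclp_trans sympD)
  then show ?thesis using assms Br_less[OF assms] Br_center[OF assms] by (auto simp: Br_iff)
qed

text \<open>If the component of \<open>m\<close> missed \<open>k\<close>, then \<open>A\<close>
  would annihilate column \<open>k\<close> of \<open>V\<close> on that component, which has no outer
  neighbours. By \<open>A_closed_kernel\<close> this would make \<open>V m k\<close> zero, against
  \<open>V_pos\<close>.\<close>

lemma nb_connected:
  assumes "m < N" "k < N"
  shows "nb\<^sup>*\<^sup>* m k"
proof (rule ccontr)
  assume k: "\<not> nb\<^sup>*\<^sup>* m k"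
  have "i < N" if "nb\<^sup>*\<^sup>* m i" for i
    using that assms by (induction rule: rtranclp_induct) (auto dest: nb_less)
  then have "V m k = 0"
    using k assms
    by (intro A_closed_kernel[of "{i. nb\<^sup>*\<^sup>* m i}" "\<lambda>i. V i k" m])
      (auto simp: A_V intro: rtranclp.rtrancl_into_rtrancl)
  then show False using V_pos[OF assms] by simp
qed

lemma Br_cover:
  assumes "m < N" "i < N" "i \<noteq> m"
  shows "\<exists>n. nb m n \<and> i \<in> Br m n"
  using nb_connected[OF assms(1,2)] assms(3)
proof (induction rule: rtranclp_induct)
  case (step y z)
  show ?case
  proof (cases "y = m")
    case True
    then show ?thesis using step Br_self by blast
  next
    case False
    then show ?thesis using step Br_closed by blast
  qed
qed simp

text \<open>If the removal of an edge at \<open>m\<close> left the graph connected, then fewer than \<open>N - 1\<close> edges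
  would connect \<open>N\<close> vertices.\<close>

lemma nb_acyclic:
  assumes "nb m n" "nb m n'" "n' \<in> Br m n"
  shows "n' = n"
proof (rule ccontr)
  assume ne: "n' \<noteq> n"
  define E where "E = {(a, b). nb a b}"
  define R where "R = E - {(m, n'), (n', m)}"
  have E: "E = (SIGMA a:{..<N}. {b. nb a b})" by (auto simp: E_def dest: nb_less)
  have "int (card E) = 2 * int N - 2"
    unfolding E using sum_val by (simp add: card_SigmaI finite_nb valence_def)
  moreover have finE: "finite E" unfolding E by (auto intro: finite_nb)
  have "n' \<noteq> m" using assms nb_irrefl by blast
  then have "card R = card E - 2" "2 \<le> card E"
    using assms nb_sym card_mono[OF finE, of "{(m, n'), (n', m)}"]
    by (auto simp: R_def E_def card_Diff_subset)
  ultimately have cR: "int (card R) < 2 * int N - 2" by linarith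
  have mn: "(m, n) \<in> R" using assms ne nb_irrefl by (auto simp: R_def E_def)
  have reach': "(m, i) \<in> R\<^sup>*" if "i \<in> Br m n" for i
    using that
  proof (induction rule: Br_induct)
    case base
    then show ?case using mn by blast
  next
    case (step i j)
    then have "(i, j) \<in> R" by (auto simp: R_def E_def)
    then show ?case using step by (meson rtrancl.rtrancl_into_rtrancl)
  qed
  have "(m, i) \<in> R\<^sup>*" if "i \<in> {..<N}" for i
  proof (cases "i = m")
    case False
    have "nb\<^sup>*\<^sup>* m i" using nb_connected that assms nb_less by auto
    then show ?thesis
    proof (induction rule: rtranclp_induct)
      case (step y z)
      show ?case
      proof (cases "(y, z) \<in> R")
        case True
        then show ?thesis using step by (meson rtrancl.rtrancl_into_rtrancl)
      next
        case False
        then have "z = n' \<or> z = m" using step by (auto simp: R_def E_def)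
        then show ?thesis using reach' assms by blast
      qed
    qed simp
  qed simp
  moreover have "sym R" by (auto simp: sym_def R_def E_def nb_sym)
  moreover have "m < N" using assms nb_less by blast
  ultimately have "2 * (card {..<N} - 1) \<le> card R"
    using finE by (intro symmetric_connected_card[of _ _ m]) (auto simp: R_def)
  then show False using cR by simp
qed

lemma Br_disjoint:
  assumes "nb m n" "nb m n'" "i \<in> Br m n" "i \<in> Br m n'"
  shows "n = n'"
  using nb_acyclic[of m n n'] assms Br_eq[of i m n] Br_eq[of i m n'] Br_self by metis

lemma Br_child_center:
  assumes "nb m n" "nb n j" "j \<noteq> m"
  shows "m \<notin> Br n j"
  using nb_acyclic[of n j m] assms nb_sym by blast

lemma Br_child_subset:
  assumes "nb m n" "nb n j" "j \<noteq> m"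
  shows "Br n j \<subseteq> Br m n - {n}"
proof
  fix i assume i: "i \<in> Br n j"
  have "n \<noteq> m" using assms nb_irrefl by blast
  from i have "i \<in> Br m n"
  proof (induction rule: Br_induct)
    case base
    show ?case using Br_closed[OF Br_self[OF assms(1)] \<open>n \<noteq> m\<close> assms(2,3)] .
  next
    case (step i k)
    have "k \<in> Br n j" using step Br_closed by blast
    then have "k \<noteq> m" using Br_child_center[OF assms] by blast
    moreover have "i \<noteq> m" using step Br_child_center[OF assms] by blast
    ultimately show ?case using step Br_closed by blast
  qed
  then show "i \<in> Br m n - {n}" using Br_center[OF i] by simp
qed

lemma Br_decomp:
  assumes "nb m n"
  shows "Br m n = insert n (\<Union>j\<in>{j. nb n j} - {m}. Br n j)"
proof (intro equalityI subsetI)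
  fix i assume "i \<in> Br m n"
  then show "i \<in> insert n (\<Union>j\<in>{j. nb n j} - {m}. Br n j)"
  proof (induction rule: Br_induct)
    case (step i k)
    show ?case
    proof (cases "i = n \<or> k = n")
      case True
      then show ?thesis using step Br_self by blast
    next
      case False
      then show ?thesis using step Br_closed by blast
    qed
  qed simp
qed (use Br_child_subset[OF assms] Br_self[OF assms] in auto)

text \<open>Both sides, as functions of \<open>i\<close> on the branch, solve the same linear system with the same
  boundary value at \<open>n\<close>.\<close>

lemma V_sep:
  assumes "i \<in> Br n j" "k \<notin> Br n j" "k < N" "n < N"
  shows "V n n * V i k = V i n * V n k"
proof -
  let ?x = "\<lambda>i. V n n * V i k - V i n * V n k"
  have "?x i = 0"
  proof (rule A_closed_kernel[of "Br n j" ?x])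
    fix l assume l: "l \<in> Br n j"
    have "(\<Sum>r<N. A l r * ?x r) = V n n * (\<Sum>r<N. A l r * V r k) - (\<Sum>r<N. A l r * V r n) * V n k"
      by (simp add: sum_distrib_left sum_distrib_right sum_subtractf algebra_simps)
    also have "\<dots> = 0" using l Br_less[OF l] Br_center[OF l] assms by (auto simp: A_V)
    finally show "(\<Sum>r<N. A l r * ?x r) = 0" .
  next
    fix l r assume "l \<in> Br n j" "nb l r" "r \<notin> Br n j"
    then have "r = n" using Br_closed Br_center by blast
    then show "?x r = 0" by simp
  qed (use assms Br_less in auto)
  then show ?thesis by simp
qed

section \<open>Identities and divisibilities between the entries of \<open>V\<close> along an
  edge\<close>

lemma V_diag:
  assumes "m < N"
  shows "A m m * V m m = 1 + (\<Sum>j | nb m j. V j m)"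
  using A_V[OF assms assms] A_row[OF assms, of "\<lambda>j. V j m"] by simp

text \<open>In row \<open>m\<close> of \<open>A V = 1\<close>, every neighbour other than
  \<open>n\<close> is separated from \<open>i\<close> by \<open>m\<close>. By \<open>V_sep\<close>
  its term is a multiple of \<open>V m i\<close>, and only the term of \<open>n\<close>
  remains.\<close>

lemma V_edge:
  assumes "nb m n" "i \<in> Br m n"
  shows "V m m * V n i = (1 + V n m) * V m i"
proof -
  have i: "i < N" "i \<noteq> m" and m: "m < N" using assms Br_less Br_center nb_less by blast+
  have "A m m * V m i = (\<Sum>j | nb m j. V j i)"
    using A_V[of m i] A_row[of m "\<lambda>j. V j i"] i m by simp
  then have "V m m * (A m m * V m i) = (\<Sum>j | nb m j. V m m * V j i)"
    by (simp add: sum_distrib_left)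
  also have "\<dots> = V m m * V n i + (\<Sum>j\<in>{j. nb m j} - {n}. V m m * V j i)"
    using assms finite_nb by (intro sum.remove) auto
  also have "(\<Sum>j\<in>{j. nb m j} - {n}. V m m * V j i) = (\<Sum>j\<in>{j. nb m j} - {n}. V j m * V m i)"
    using assms i m Br_disjoint Br_self by (intro sum.cong refl V_sep) auto
  also have "\<dots> = ((\<Sum>j | nb m j. V j m) - V n m) * V m i"
    using assms finite_nb by (simp add: sum_diff1 sum_distrib_right left_diff_distrib)
  finally have "(A m m * V m m) * V m i = V m m * V n i + ((\<Sum>j | nb m j. V j m) - V n m) * V m i"
    by (simp add: algebra_simps)
  then show ?thesis unfolding V_diag[OF m] by (simp add: algebra_simps)
qed

text \<open>Paths from \<open>m\<close> into the branch pass through \<open>n\<close>, so this is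
  \<open>V_sep\<close> with centre \<open>n\<close>.\<close>

lemma V_through:
  assumes "nb m n" "i \<in> Br m n"
  shows "V n n * V m i = V n m * V n i"
proof (cases "i = n")
  case True
  then show ?thesis using assms nb_less V_sym[of m n] by simp
next
  case False
  then obtain j where j: "nb n j" "j \<noteq> m" "i \<in> Br n j" using assms Br_decomp by blast
  have "V n n * V i m = V i n * V n m"
    using V_sep[OF j(3) Br_child_center[OF assms(1) j(1,2)]] assms nb_less by blast
  then show ?thesis using V_sym assms nb_less Br_less by (metis mult.commute)
qed

lemma V_dvd_other:
  assumes "nb m n" "nb m n'" "n \<noteq> n'" "i \<in> Br m n'"
  shows "V m m dvd V n m * V m i"
  using V_sep[of n m n i] Br_disjoint Br_self assms nb_less Br_less by (metis dvd_triv_left)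

section \<open>Extending a vector over a branch\<close>

text \<open>These are the coefficients in the dual basis, the hatted ones. For
  \<open>w = f + k + 1\<close>, antinefness of \<open>f\<close> reads
  \<open>2 - val i \<le> hat w i\<close>.\<close>

definition hat :: "(nat \<Rightarrow> int) \<Rightarrow> nat \<Rightarrow> int" where
  "hat w i = (\<Sum>j<N. A i j * w j)"

lemma hat_row: "i < N \<Longrightarrow> hat w i = A i i * w i - (\<Sum>j | nb i j. w j)"
  unfolding hat_def by (rule A_row)

lemma hat_cong:
  assumes "i < N" "w i = w' i" "\<And>j. nb i j \<Longrightarrow> w j = w' j"
  shows "hat w i = hat w' i"
  using assms by (auto simp: hat_row intro!: sum.cong)

text \<open>A vertex of a branch at \<open>n\<close> has all its neighbours in that branch or equal
  to \<open>n\<close>, so different branches can be extended independently. The root of each branch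
  keeps its value, hence \<open>hat\<close> at \<open>n\<close> is not affected.\<close>

lemma glue_branches:
  assumes C: "C \<subseteq> {j. nb n j}"
    and ext: "\<And>j. j \<in> C \<Longrightarrow> \<exists>w'. (\<forall>i. i \<notin> Br n j - {j} \<longrightarrow> w' i = w i) \<and>
      (\<forall>i\<in>Br n j. R i (hat w' i) (w' i))"
  shows "\<exists>w'. (\<forall>i. i \<notin> (\<Union>j\<in>C. Br n j - {j}) \<longrightarrow> w' i = w i) \<and>
    (\<forall>j\<in>C. \<forall>i\<in>Br n j. R i (hat w' i) (w' i))"
proof -
  obtain W where W1: "\<And>j i. j \<in> C \<Longrightarrow> i \<notin> Br n j - {j} \<Longrightarrow> W j i = w i"
    and W2: "\<And>j i. j \<in> C \<Longrightarrow> i \<in> Br n j \<Longrightarrow> R i (hat (W j) i) (W j i)"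
    using ext by metis
  define w' where "w' i = (if \<exists>j\<in>C. i \<in> Br n j then W (SOME j. j \<in> C \<and> i \<in> Br n j) i else w i)" for i
  have w': "w' i = W j i" if "j \<in> C" "i \<in> Br n j" for i j
  proof -
    have "(SOME j. j \<in> C \<and> i \<in> Br n j) = j"
      using that C Br_disjoint[of n _ j i] by (intro some_equality) auto
    then show ?thesis using that by (auto simp: w'_def)
  qed
  have "w' i = w i" if "i \<notin> (\<Union>j\<in>C. Br n j - {j})" for i
  proof (cases "\<exists>j\<in>C. i \<in> Br n j")
    case True
    then obtain j where "j \<in> C" "i \<in> Br n j" by blast
    then show ?thesis using w' W1[of j i] that by auto
  qed (auto simp: w'_def)
  moreover have "R i (hat w' i) (w' i)" if j: "j \<in> C" and i: "i \<in> Br n j" for i j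
  proof -
    have n: "n \<notin> Br n k" for k using Br_center by blast
    have "hat w' i = hat (W j) i"
    proof (rule hat_cong)
      fix l assume l: "nb i l"
      show "w' l = W j l"
      proof (cases "l = n")
        case True
        then show ?thesis using W1[OF j, of n] n by (simp add: w'_def)
      next
        case False
        then have "l \<in> Br n j" using Br_closed[OF i Br_center[OF i] l] by blast
        then show ?thesis using w' j by blast
      qed
    qed (use i j w' Br_less in auto)
    then show ?thesis using W2[OF j i] w'[OF j i] by simp
  qed
  ultimately show ?thesis by blast
qed

text \<open>Balance at \<open>n\<close>, from \<open>hat_row\<close> with the diagonal entry
  eliminated by \<open>V_diag\<close>: a term for the edge to \<open>m\<close> minus the numerators
  of the edges leading away from \<open>m\<close>.\<close>

lemma hat_edge:
  assumes "nb m n"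
  shows "V n n * hat w n = ((1 + V m n) * w n - V n n * w m)
    - (\<Sum>j\<in>{j. nb n j} - {m}. V n n * w j - V j n * w n)"
proof -
  let ?C = "{j. nb n j} - {m}"
  have n: "n < N" and mn: "m \<in> {j. nb n j}" using assms nb_less nb_sym by blast+
  have split: "(\<Sum>j | nb n j. f j) = f m + (\<Sum>j\<in>?C. f j)" for f :: "nat \<Rightarrow> int"
    by (rule sum.remove[OF finite_nb mn])
  have "V n n * hat w n = (A n n * V n n) * w n - V n n * (w m + (\<Sum>j\<in>?C. w j))"
    using n by (simp add: hat_row split algebra_simps)
  also have "\<dots> = (1 + (V m n + (\<Sum>j\<in>?C. V j n))) * w n - V n n * (w m + (\<Sum>j\<in>?C. w j))"
    using V_diag[OF n] by (simp add: split)
  finally show ?thesis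
    by (simp add: sum_subtractf sum_distrib_left sum_distrib_right algebra_simps)
qed

text \<open>Up to positive factors, the term for \<open>m\<close> in \<open>hat_edge\<close> is the
  numerator of the same edge seen from \<open>m\<close>. The reason is
  \<open>V m m * V n n = V m n * (1 + V m n)\<close>, which is \<open>V_edge\<close> at
  \<open>n\<close> itself.\<close>

lemma edge_form:
  assumes "nb m n"
  shows "V m n * ((1 + V m n) * w n - V n n * w m) = V n n * (V m m * w n - V n m * w m)"
proof -
  have "V m m * V n n = (1 + V n m) * V m n" using V_edge[OF assms Br_self[OF assms]] .
  moreover have "V m n = V n m" using V_sym nb_less assms by blast
  ultimately have "V m n * (1 + V m n) = V n n * V m m" "V m n = V n m"
    by (simp_all add: mult.commute)
  then have "V m n * ((1 + V m n) * w n) = V n n * (V m m * w n)" "V m n * (V n n * w m) = V n n * (V n m * w m)"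
    by (metis mult.assoc) (simp add: \<open>V m n = V n m\<close>)
  then show ?thesis by (simp only: right_diff_distrib)
qed

lemma val_child:
  assumes "nb m n"
  shows "val n = int (card ({j. nb n j} - {m})) + 1"
proof -
  have "m \<in> {j. nb n j}" using nb_sym assms by simp
  from card_Suc_Diff1[OF finite_nb this] show ?thesis unfolding valence_def by linarith
qed

text \<open>Modulo \<open>V n n\<close>, the factor \<open>V k n\<close> kills the numerator of
  every neighbour \<open>l \<noteq> k\<close> by \<open>V_dvd_other\<close>, and the divisible sum
  extends this to \<open>l = k\<close>. As \<open>V_diag\<close> writes 1 as a combination of
  \<open>V n n\<close> and all \<open>V k n\<close>, the numerator itself vanishes.\<close>

lemma child_numerators_dvd:
  assumes "nb m n" "V n n dvd (\<Sum>j\<in>{j. nb n j} - {m}. V n n * w j - V j n * w n)"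
    and j: "nb n j" "j \<noteq> m"
  shows "V n n dvd V n n * w j - V j n * w n"
proof -
  let ?C = "{j. nb n j} - {m}" and ?X = "\<lambda>j. V n n * w j - V j n * w n"
  have n: "n < N" using assms nb_less by blast
  have other: "V n n dvd V k n * ?X l" if kl: "nb n k" "nb n l" "k \<noteq> l" for k l
  proof -
    have "V n n dvd V k n * V l n"
      using V_dvd_other[OF kl Br_self] kl V_sym[of n l] nb_less by metis
    moreover have "V k n * ?X l = V n n * (V k n * w l) - (V k n * V l n) * w n"
      by (simp add: algebra_simps)
    ultimately show ?thesis by (metis dvd_diff dvd_mult2 dvd_triv_left)
  qed
  have jC: "j \<in> ?C" using j by simp
  have "(\<Sum>l\<in>?C. ?X l) = ?X j + (\<Sum>l\<in>?C - {j}. ?X l)"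
    using finite_nb by (intro sum.remove[OF _ jC]) simp
  then have "V j n * ?X j = V j n * (\<Sum>l\<in>?C. ?X l) - (\<Sum>l\<in>?C - {j}. V j n * ?X l)"
    by (simp only: sum_distrib_left[symmetric] distrib_left)
  also have "V n n dvd \<dots>"
    using other[OF j(1)] by (intro dvd_diff dvd_mult[OF assms(2)] dvd_sum) auto
  finally have self: "V n n dvd V j n * ?X j" .
  have "?X j = V n n * (A n n * ?X j) - (\<Sum>k | nb n k. V k n * ?X j)"
  proof -
    have "?X j = (A n n * V n n - (\<Sum>k | nb n k. V k n)) * ?X j" using V_diag[OF n] by simp
    then show ?thesis by (simp only: left_diff_distrib sum_distrib_right mult.assoc mult.left_commute)
  qed
  also have "V n n dvd \<dots>"
  proof (intro dvd_diff dvd_sum)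
    fix k assume "k \<in> {k. nb n k}"
    then show "V n n dvd V k n * ?X j" using self other[of k j] j by (cases "k = j") auto
  qed simp
  finally show ?thesis .
qed

text \<open>If equality held at the edge \<open>m n\<close>, the divisibility above would force equality at an edge from
  \<open>n\<close> to one of its other neighbours, and so on until a leaf, where it contradicts the lower
  bound for \<open>hat w\<close>.\<close>

lemma not_tight:
  assumes "nb m n"
    and "\<And>i. i \<in> Br m n \<Longrightarrow> 2 - val i \<le> hat w i"
    and "\<And>i. i \<in> Br m n \<Longrightarrow> V i m * w m \<le> V m m * w i"
  shows "V m m * w n \<noteq> V n m * w m"
  using assms
proof (induction "card (Br m n)" arbitrary: m n rule: less_induct)
  case less
  note mn = \<open>nb m n\<close>
  let ?C = "{j. nb n j} - {m}" and ?X = "\<lambda>j. V n n * w j - V j n * w n"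
  have m: "m < N" and n: "n < N" using mn nb_less by blast+
  have pos: "0 < V m m" "0 < V n n" "0 < V m n" using m n V_pos by auto
  show ?case
  proof
    assume tight: "V m m * w n = V n m * w m"
    then have "V m n * ((1 + V m n) * w n - V n n * w m) = 0" using edge_form[OF mn, of w] by simp
    then have sum: "V n n * hat w n = - (\<Sum>j\<in>?C. ?X j)" using hat_edge[OF mn, of w] pos by simp
    \<comment> \<open>Tightness moves the lower bound from centre \<open>m\<close> to centre
      \<open>n\<close>, as the induction hypothesis requires.\<close>
    have low: "V i n * w n \<le> V n n * w i" if i: "i \<in> Br m n" for i
    proof -
      have iN: "i < N" using Br_less i by blast
      have "V m m * (V i n * w n) = V i n * (V n m * w m)" using tight by (simp add: algebra_simps)
      also have "\<dots> = V n n * (V i m * w m)"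
        using V_through[OF mn i] V_sym[of i n] V_sym[of i m] iN m n by (simp add: algebra_simps)
      also have "\<dots> \<le> V n n * (V m m * w i)" using less.prems(3)[OF i] pos by simp
      finally have "V m m * (V i n * w n) \<le> V m m * (V n n * w i)" by (simp add: algebra_simps)
      then show ?thesis using pos by simp
    qed
    have sub: "Br n j \<subseteq> Br m n - {n}" if "j \<in> ?C" for j using Br_child_subset[OF mn] that by simp
    have "(\<Sum>j\<in>?C. ?X j) = V n n * (- hat w n)" using sum by simp
    then have "V n n dvd (\<Sum>j\<in>?C. ?X j)" by (rule dvdI)
    then have dvd: "V n n dvd ?X j" if "j \<in> ?C" for j using child_numerators_dvd[OF mn] that by auto
    have "\<exists>j\<in>?C. ?X j = 0"
    proof (rule ccontr)
      assume nz: "\<not> (\<exists>j\<in>?C. ?X j = 0)"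
      \<comment> \<open>Positive multiples of \<open>V n n\<close> are at least
        \<open>V n n\<close>, which forces \<open>hat w n\<close> down to \<open>1 - val n\<close>,
        one below the bound. At a leaf \<open>?C\<close> is empty and the contradiction is
        immediate.\<close>
      have "V n n \<le> ?X j" if j: "j \<in> ?C" for j
      proof -
        have "j \<in> Br m n" using sub[OF j] Br_self j by blast
        then have "0 \<le> ?X j" using low[of j] by simp
        moreover have "?X j \<noteq> 0" using nz j by blast
        ultimately have "0 < ?X j" by simp
        then show ?thesis using dvd[OF j] zdvd_imp_le by blast
      qed
      then have "(\<Sum>j\<in>?C. V n n) \<le> (\<Sum>j\<in>?C. ?X j)" by (rule sum_mono)
      then have "V n n * hat w n \<le> V n n * (- int (card ?C))" using sum by (simp add: mult.commute)
      then have "hat w n \<le> - int (card ?C)" using pos(2) by (simp only: mult_le_cancel_left_pos)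
      then show False using less.prems(2)[OF Br_self[OF mn]] val_child[OF mn] by simp
    qed
    then obtain j where j: "j \<in> ?C" "?X j = 0" by blast
    have "Br n j \<subset> Br m n" using sub[OF j(1)] Br_self[OF mn] by blast
    then have "card (Br n j) < card (Br m n)" by (rule psubset_card_mono[OF finite_Br])
    moreover have "nb n j" using j by simp
    ultimately have "V n n * w j \<noteq> V j n * w n"
      using less.hyps[of n j] less.prems(2) low sub[OF j(1)] by blast
    then show False using j by simp
  qed
qed

text \<open>This is the numerator of the paper's \<open>\<Sum>\<^bsub>i\<^esub> d\<^sub>i V\<^bsub>\<mu>,i\<^esub> / s\<close> (with hatted \<open>d\<^sub>i\<close>), and it measures how far
  \<open>d\<close> is from being proportional to row \<open>m\<close> of \<open>V\<close> along the edge (see \<open>d_edge\<close>).\<close>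

definition T :: "(nat \<Rightarrow> nat) \<Rightarrow> nat \<Rightarrow> nat \<Rightarrow> int" where
  "T dhat m n = (\<Sum>i\<in>Br m n. int (dhat i) * V m i)"

lemma T_nonneg: "nb m n \<Longrightarrow> 0 \<le> T dhat m n"
  unfolding T_def using V_pos nb_less Br_less by (intro sum_nonneg mult_nonneg_nonneg) (auto simp: less_imp_le)

text \<open>Indices outside the branch cancel by \<open>V_sep\<close>; those inside are evaluated by
  \<open>V_edge\<close>.\<close>

lemma d_edge:
  assumes "nb m n"
  shows "V m m * dcoef N prox dhat n - V n m * dcoef N prox dhat m = T dhat m n"
proof -
  have m: "m < N" and n: "n < N" using assms nb_less by blast+
  have "V m m * dcoef N prox dhat n - V n m * dcoef N prox dhat m
      = (\<Sum>i<N. int (dhat i) * (V m m * V n i - V n m * V m i))"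
    unfolding dcoef_def sum_distrib_left sum_subtractf[symmetric]
    using m n by (intro sum.cong) (auto simp: V_sym algebra_simps)
  also have "\<dots> = (\<Sum>i<N. if i \<in> Br m n then int (dhat i) * V m i else 0)"
  proof (intro sum.cong refl)
    fix i assume i: "i \<in> {..<N}"
    show "int (dhat i) * (V m m * V n i - V n m * V m i) = (if i \<in> Br m n then int (dhat i) * V m i else 0)"
    proof (cases "i \<in> Br m n")
      case True
      then show ?thesis using V_edge[OF assms True] by (simp add: algebra_simps)
    next
      case False
      then show ?thesis using V_sep[OF Br_self[OF assms] False] i m by simp
    qed
  qed
  also have "\<dots> = T dhat m n" unfolding T_def
    by (rule sum.mono_neutral_cong_right) (auto dest: Br_less)
  finally show ?thesis .
qed

text \<open>The branches beyond \<open>n\<close> fill \<open>Br m n\<close> except for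
  \<open>n\<close>, whose nonnegative term is dropped; \<open>V_through\<close> passes from row
  \<open>n\<close> to row \<open>m\<close>.\<close>

lemma T_children:
  assumes "nb m n"
  shows "V m n * (\<Sum>j\<in>{j. nb n j} - {m}. T dhat n j) \<le> V n n * T dhat m n"
proof -
  let ?C = "{j. nb n j} - {m}"
  have m: "m < N" and n: "n < N" using assms nb_less by blast+
  have "(\<Sum>j\<in>?C. T dhat n j) = (\<Sum>i\<in>(\<Union>j\<in>?C. Br n j). int (dhat i) * V n i)"
    unfolding T_def using finite_nb finite_Br Br_disjoint
    by (intro sum.UNION_disjoint[symmetric]) (auto simp: disjoint_iff)
  also have "\<dots> \<le> (\<Sum>i\<in>Br m n. int (dhat i) * V n i)"
  proof (rule sum_mono2[OF finite_Br])
    show "(\<Union>j\<in>?C. Br n j) \<subseteq> Br m n" using Br_decomp[OF assms] by blast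
    fix i assume "i \<in> Br m n - (\<Union>j\<in>?C. Br n j)"
    then have "0 < V n i" using Br_less V_pos[OF n] by blast
    then show "0 \<le> int (dhat i) * V n i" by simp
  qed
  finally have "V m n * (\<Sum>j\<in>?C. T dhat n j) \<le> V m n * (\<Sum>i\<in>Br m n. int (dhat i) * V n i)"
    using V_pos[OF m n] by simp
  also have "\<dots> = V n n * T dhat m n"
    unfolding T_def sum_distrib_left using V_through[OF assms] V_sym[OF m n]
    by (intro sum.cong) (auto simp: algebra_simps)
  finally show ?thesis .
qed

text \<open>The values are chosen outwards along the tree, each being the least integer that satisfies the
  last two hypotheses for the next edge.\<close>

lemma extend_branch:
  fixes \<xi> :: rat
  assumes "0 \<le> \<xi>" "nb m n"
    and "\<xi> * of_int (dcoef N prox dhat m) \<le> of_int (w m)"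
    and "V n m * w m < V m m * w n"
    and "\<xi> * of_int (T dhat m n) \<le> of_int (V m m * w n - V n m * w m)"
  shows "\<exists>w'. (\<forall>i. i \<notin> Br m n - {n} \<longrightarrow> w' i = w i) \<and>
    (\<forall>i\<in>Br m n. 2 - val i \<le> hat w' i \<and> \<xi> * of_int (dcoef N prox dhat i) \<le> of_int (w' i))"
  using assms(2-)
proof (induction "card (Br m n)" arbitrary: m n w rule: less_induct)
  case less
  note mn = \<open>nb m n\<close>
  let ?C = "{j. nb n j} - {m}" and ?d = "dcoef N prox dhat"
  let ?\<tau> = "\<lambda>j. \<xi> * of_int (T dhat n j)"
  have m: "m < N" and n: "n < N" using mn nb_less by blast+
  have pos: "0 < V m m" "0 < V n n" "0 < V m n" "0 < V n m" using m n V_pos by auto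
  have finC: "finite ?C" using finite_nb by simp
  have nC: "n \<notin> ?C" using nb_irrefl by simp
  have sub: "Br n j \<subseteq> Br m n - {n}" if "j \<in> ?C" for j using Br_child_subset[OF mn] that by simp
  have mBr: "m \<notin> Br m n" using Br_center by blast
  have dn: "\<xi> * of_int (?d n) \<le> of_int (w n)"
  proof -
    have "of_int (V m m) * (\<xi> * of_int (?d n)) = of_int (V n m) * (\<xi> * of_int (?d m)) + \<xi> * of_int (T dhat m n)"
      unfolding d_edge[OF mn, symmetric] by (simp add: algebra_simps)
    also have "\<dots> \<le> of_int (V n m) * of_int (w m) + of_int (V m m * w n - V n m * w m)"
      using less.prems(2,4) pos by (intro add_mono mult_left_mono) auto
    also have "\<dots> = of_int (V m m) * of_int (w n)" by simp
    finally show ?thesis using pos by simp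
  qed
  have "\<exists>c. \<forall>j\<in>?C. V j n * w n < V n n * c j \<and> ?\<tau> j \<le> of_int (V n n * c j - V j n * w n) \<and>
      of_int (V n n * (c j - 1)) \<le> of_int (V j n * w n) + ?\<tau> j \<and>
      (?\<tau> j > 0 \<longrightarrow> of_int (V n n * (c j - 1)) < of_int (V j n * w n) + ?\<tau> j)"
    using assms(1) T_nonneg by (intro bchoice ballI least_int_above[OF pos(2)]) simp
  then obtain c where c1: "\<And>j. j \<in> ?C \<Longrightarrow> V j n * w n < V n n * c j"
    and c2: "\<And>j. j \<in> ?C \<Longrightarrow> ?\<tau> j \<le> of_int (V n n * c j - V j n * w n)"
    and c3: "\<And>j. j \<in> ?C \<Longrightarrow> of_int (V n n * (c j - 1)) \<le> of_int (V j n * w n) + ?\<tau> j"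
    and c4: "\<And>j. j \<in> ?C \<Longrightarrow> ?\<tau> j > 0 \<Longrightarrow> of_int (V n n * (c j - 1)) < of_int (V j n * w n) + ?\<tau> j"
    by blast
  define w1 where "w1 i = (if i \<in> ?C then c i else w i)" for i
  have w1n: "w1 n = w n" using nC unfolding w1_def by meson
  have "\<exists>w'. (\<forall>i. i \<notin> Br n j - {j} \<longrightarrow> w' i = w1 i) \<and>
    (\<forall>i\<in>Br n j. 2 - val i \<le> hat w' i \<and> \<xi> * of_int (?d i) \<le> of_int (w' i))" if j: "j \<in> ?C" for j
  proof -
    have "Br n j \<subset> Br m n" using sub[OF j] Br_self[OF mn] by blast
    then have "card (Br n j) < card (Br m n)" by (rule psubset_card_mono[OF finite_Br])
    moreover have "nb n j" using j by simp
    moreover have "w1 j = c j" using j by (simp add: w1_def)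
    ultimately show ?thesis using less.hyps[of n j w1] dn c1[OF j] c2[OF j] w1n by simp
  qed
  then have "\<exists>w'. (\<forall>i. i \<notin> (\<Union>j\<in>?C. Br n j - {j}) \<longrightarrow> w' i = w1 i) \<and>
    (\<forall>j\<in>?C. \<forall>i\<in>Br n j. 2 - val i \<le> hat w' i \<and> \<xi> * of_int (?d i) \<le> of_int (w' i))"
    by (intro glue_branches[where R = "\<lambda>i h x. 2 - val i \<le> h \<and> \<xi> * of_int (?d i) \<le> of_int x"]) blast+
  then obtain w' where "\<forall>i. i \<notin> (\<Union>j\<in>?C. Br n j - {j}) \<longrightarrow> w' i = w1 i"
    "\<forall>j\<in>?C. \<forall>i\<in>Br n j. 2 - val i \<le> hat w' i \<and> \<xi> * of_int (?d i) \<le> of_int (w' i)"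
    by (elim exE conjE)
  note off = this(1)[rule_format] and on_child = this(2)[THEN bspec, THEN bspec]
  have w'_out: "w' i = w i" if i: "i \<notin> Br m n - {n}" for i
  proof -
    have "i \<notin> Br n j" if "j \<in> ?C" for j using sub[OF that] i by blast
    moreover have "i \<notin> ?C" using sub[of i] Br_self[of n i] i by blast
    ultimately show ?thesis using off[of i] by (simp only: w1_def if_False) blast
  qed
  have w'n: "w' n = w n" and w'm: "w' m = w m" using w'_out mBr by auto
  have w'c: "w' j = c j" if j: "j \<in> ?C" for j
  proof -
    have "j \<notin> Br n k - {k}" if "k \<in> ?C" for k
      using Br_disjoint[of n j k j] Br_self j that by blast
    then show ?thesis using off[of j] j by (auto simp: w1_def)
  qed
  let ?G = "(1 + V m n) * w n - V n n * w m" and ?H = "V m m * w n - V n m * w m"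
  \<comment> \<open>By \<open>val_child\<close> the bound at \<open>n\<close> says
    \<open>0 < ?Y\<close>. Adding \<open>card ?C\<close> turns each \<open>c j\<close> into
    \<open>c j - 1\<close>, to which the leastness bounds apply.\<close>
  let ?Y = "hat w' n + int (card ?C)" and ?S = "\<Sum>j\<in>?C. ?\<tau> j"
  have GH: "V m n * ?G = V n n * ?H" using edge_form[OF mn] .
  have "0 < V n n * ?H" using less.prems(3) pos by simp
  then have G: "0 < ?G" unfolding GH[symmetric] using pos by (simp add: zero_less_mult_iff)
  have S: "?S \<le> of_int ?G"
  proof -
    have "of_int (V m n) * ?S = \<xi> * of_int (V m n * (\<Sum>j\<in>?C. T dhat n j))"
      by (simp add: sum_distrib_left algebra_simps)
    also have "\<dots> \<le> \<xi> * of_int (V n n * T dhat m n)"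
      using T_children[OF mn] assms(1) by (intro mult_left_mono) (simp_all only: of_int_le_iff)
    also have "\<dots> = of_int (V n n) * (\<xi> * of_int (T dhat m n))" by simp
    also have "\<dots> \<le> of_int (V n n) * of_int ?H" using less.prems(4) pos by (intro mult_left_mono) auto
    also have "\<dots> = of_int (V m n) * of_int ?G" unfolding of_int_mult[symmetric] GH ..
    finally show ?thesis using pos by simp
  qed
  have "V n n * hat w' n = ?G - (\<Sum>j\<in>?C. V n n * c j - V j n * w n)"
    using hat_edge[OF mn, of w'] w'n w'm w'c by simp
  then have "V n n * ?Y = ?G - (\<Sum>j\<in>?C. V n n * (c j - 1) - V j n * w n)"
    using finC by (simp add: sum_subtractf right_diff_distrib distrib_left)
  then have Y: "(of_int (V n n * ?Y) :: rat)
      = of_int ?G - (\<Sum>j\<in>?C. of_int (V n n * (c j - 1)) - of_int (V j n * w n))"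
    by (metis (no_types, lifting) of_int_diff of_int_sum sum.cong)
  \<comment> \<open>Strictness comes from a strict leastness bound if some threshold
    \<open>?\<tau> j\<close> is positive, and from \<open>0 < ?G\<close> otherwise.\<close>
  have "(0::rat) < of_int (V n n * ?Y)"
  proof (cases "\<exists>j\<in>?C. ?\<tau> j > 0")
    case True
    have "(\<Sum>j\<in>?C. of_int (V n n * (c j - 1)) - of_int (V j n * w n)) < ?S"
    proof (rule sum_strict_mono_ex1[OF finC])
      show "\<forall>j\<in>?C. of_int (V n n * (c j - 1)) - of_int (V j n * w n) \<le> ?\<tau> j"
        using c3 by (auto simp only: diff_le_eq add.commute)
      show "\<exists>j\<in>?C. of_int (V n n * (c j - 1)) - of_int (V j n * w n) < ?\<tau> j"
        using c4 True by (auto simp only: diff_less_eq add.commute)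
    qed
    then show ?thesis using Y S by linarith
  next
    case False
    have "(\<Sum>j\<in>?C. of_int (V n n * (c j - 1)) - of_int (V j n * w n)) \<le> (\<Sum>j\<in>?C. 0::rat)"
    proof (rule sum_mono)
      fix j assume j: "j \<in> ?C"
      then have "?\<tau> j \<le> 0" using False by force
      then show "of_int (V n n * (c j - 1)) - of_int (V j n * w n) \<le> (0::rat)"
        using c3[OF j] by linarith
    qed
    moreover have "(0::rat) < of_int ?G" using G by (simp only: of_int_0_less_iff)
    ultimately show ?thesis using Y by simp
  qed
  then have "0 < V n n * ?Y" by (simp only: of_int_0_less_iff)
  then have "0 < ?Y" using pos by (simp add: zero_less_mult_iff)
  then have at_n: "2 - val n \<le> hat w' n" using val_child[OF mn] by simp
  have "2 - val i \<le> hat w' i \<and> \<xi> * of_int (?d i) \<le> of_int (w' i)" if "i \<in> Br m n" for i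
  proof (cases "i = n")
    case True
    then show ?thesis using at_n dn w'n by simp
  next
    case False
    have "i \<in> insert n (\<Union>j\<in>?C. Br n j)" using that by (subst (asm) Br_decomp[OF mn])
    with False obtain j where "j \<in> ?C" "i \<in> Br n j" by (elim insertE UN_E) auto
    then show ?thesis by (rule on_child)
  qed
  then show ?case using w'_out by blast
qed

section \<open>Jumping numbers supported at a vertex\<close>

abbreviation s where "s m n \<equiv> int (sgcd N prox m n)"

lemma s_eq_Gcd:
  assumes "m < N"
  shows "s m n = Gcd (V m ` (Br m n \<union> {m}))"
proof -
  have "int ` ((\<lambda>i. nat (V m i)) ` (Br m n \<union> {m})) = V m ` (Br m n \<union> {m})"
    unfolding image_image
    using V_pos[OF assms] assms Br_less by (intro image_cong) (auto simp: less_imp_le)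
  then show ?thesis
    unfolding sgcd_def SV_def Gcd_gen_monoid by (simp only: Gcd_int_eq[symmetric])
qed

lemma s_dvd: "m < N \<Longrightarrow> i \<in> Br m n \<union> {m} \<Longrightarrow> s m n dvd V m i"
  unfolding s_eq_Gcd by (rule Gcd_dvd) (rule imageI)

lemma s_pos: "m < N \<Longrightarrow> 0 < s m n"
  using s_dvd[of m m n] V_pos[of m m] by (metis UnI2 dvd_0_left_iff gr0I less_irrefl of_nat_0_less_iff of_nat_0 singletonI)

text \<open>Taking gcds commutes with multiplication by \<open>x\<close>, so divisibilities for
  single entries of \<open>V\<close> pass to \<open>s\<close>.\<close>

lemma dvd_mult_s:
  assumes "m < N" "\<And>i. i \<in> Br m n \<union> {m} \<Longrightarrow> c dvd x * V m i"
  shows "c dvd x * s m n"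
proof -
  have "c dvd Gcd ((*) x ` (V m ` (Br m n \<union> {m})))"
    using assms(2) by (intro Gcd_greatest) auto
  then show ?thesis unfolding Gcd_mult s_eq_Gcd[OF assms(1)] by simp
qed

text \<open>The branch at the centre itself is empty. Thus \<open>V m m\<close> is a generator of
  \<open>Smon\<close>; its coefficient will be the slack of the inequality at
  \<open>m\<close>.\<close>

lemma s_center: "m < N \<Longrightarrow> s m m = V m m"
  using V_pos[of m m] by (simp add: s_eq_Gcd branch_def)

lemma sgcd_Br: "i \<in> Br m n \<Longrightarrow> sgcd N prox m i = sgcd N prox m n"
  by (simp add: sgcd_def SV_def Br_eq)

lemma V_dvd_s_other:
  assumes "nb m n" "nb m k" "n \<noteq> k"
  shows "V m m dvd V n m * s m k"
  using assms V_dvd_other nb_less by (intro dvd_mult_s) auto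

lemma V_dvd_s_edge:
  assumes "nb m n"
  shows "V m m dvd (1 + V n m) * s m n"
  using assms V_edge nb_less by (intro dvd_mult_s) (auto intro: dvdI[OF sym])

text \<open>The generators depend only on the branch, so the centre and its neighbours represent all
  of them.\<close>

lemma Smon_iff:
  assumes "m < N"
  shows "x \<in> Smon N prox m \<longleftrightarrow>
    (\<exists>a c. x = a * sgcd N prox m m + (\<Sum>n | nb m n. c n * sgcd N prox m n))"
proof
  assume "x \<in> Smon N prox m"
  then show "\<exists>a c. x = a * sgcd N prox m m + (\<Sum>n | nb m n. c n * sgcd N prox m n)"
    unfolding Smon_def
  proof (induction rule: gen_monoid.induct)
    case zero
    show ?case by (intro exI[of _ 0] exI[of _ "\<lambda>_. 0"]) simp
  next
    case (add g x)
    then obtain a c where x: "x = a * sgcd N prox m m + (\<Sum>n | nb m n. c n * sgcd N prox m n)" by blast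
    obtain k where k: "k < N" "g = sgcd N prox m k" using add by auto
    show ?case
    proof (cases "k = m")
      case True
      then show ?thesis using x k by (intro exI[of _ "a + 1"] exI[of _ c]) simp
    next
      case False
      then obtain n where n: "nb m n" "k \<in> Br m n" using Br_cover assms k by blast
      have "(\<Sum>l | nb m l. (c(n := c n + 1)) l * sgcd N prox m l)
          = sgcd N prox m n + (\<Sum>l | nb m l. c l * sgcd N prox m l)"
        using n(1) finite_nb
        by (simp add: sum.remove[of "{l. nb m l}" n])
      then show ?thesis using x k sgcd_Br[OF n(2)]
        by (intro exI[of _ a] exI[of _ "c(n := c n + 1)"]) simp
    qed
  qed
next
  assume "\<exists>a c. x = a * sgcd N prox m m + (\<Sum>n | nb m n. c n * sgcd N prox m n)"
  then show "x \<in> Smon N prox m"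
    unfolding Smon_def
  proof (elim exE)
    fix a c
    let ?G = "gen_monoid (sgcd N prox m ` {..<N})"
    assume x: "x = a * sgcd N prox m m + (\<Sum>n | nb m n. c n * sgcd N prox m n)"
    have "sgcd N prox m k \<in> ?G" if "k < N" for k using that by (intro gen_monoid_base) simp
    then show "x \<in> ?G" unfolding x using assms nb_less
      by (intro gen_monoid_plus gen_monoid_sum gen_monoid_mult) auto
  qed
qed

section \<open>Supported jumping numbers in terms of integer vectors\<close>

lemma hat_add: "hat (\<lambda>i. f i + g i) i = hat f i + hat g i"
  by (simp add: hat_def distrib_left sum.distrib)

lemma antinef_iff: "antinef N prox f \<longleftrightarrow> (\<forall>i<N. 0 \<le> hat f i)"
proof -
  have "(\<Sum>j<N. f j * (transpose_mat (Pmat N prox) * Pmat N prox) $$ (j, i)) = hat f i" if "i < N" for i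
    unfolding hat_def using that by (intro sum.cong refl) (simp add: PtP_entry A_sym[of _ i] mult.commute)
  then show ?thesis unfolding antinef_def by simp
qed

lemma eq_V_hat:
  assumes "i < N"
  shows "f i = (\<Sum>j<N. V i j * hat f j)"
proof -
  have "(\<Sum>j<N. V i j * hat f j) = (\<Sum>j<N. \<Sum>k<N. V i j * A j k * f k)"
    by (simp add: hat_def sum_distrib_left mult.assoc)
  also have "\<dots> = (\<Sum>k<N. \<Sum>j<N. V i j * A j k * f k)" by (rule sum.swap)
  also have "\<dots> = (\<Sum>k<N. (\<Sum>j<N. A k j * V j i) * f k)"
    unfolding sum_distrib_right using assms
    by (intro sum.cong refl) (simp add: V_sym[of i] A_sym mult.commute)
  also have "\<dots> = (\<Sum>k<N. if k = i then f k else 0)" using assms by (intro sum.cong) (auto simp: A_V)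
  also have "\<dots> = f i" using assms by simp
  finally show ?thesis by simp
qed

text \<open>Since \<open>f = V (hat f)\<close> and \<open>V\<close> has positive entries, antinef
  divisors are effective.\<close>

lemma antinef_nonneg: "antinef N prox f \<Longrightarrow> i < N \<Longrightarrow> 0 \<le> f i"
  unfolding antinef_iff by (subst eq_V_hat) (auto intro!: sum_nonneg mult_nonneg_nonneg simp: V_pos less_imp_le)

lemma kcoef_nonneg: "i < N \<Longrightarrow> 0 \<le> kcoef N prox i"
  unfolding kcoef_def by (auto intro!: sum_nonneg Q_nonneg)

lemma dcoef_pos:
  assumes "\<exists>i<N. 0 < dhat i" "j < N"
  shows "0 < dcoef N prox dhat j"
proof -
  obtain i where i: "i < N" "0 < dhat i" using assms by blast
  have "0 < int (dhat i) * V i j" using i V_pos assms by simp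
  also have "\<dots> \<le> dcoef N prox dhat j"
    unfolding dcoef_def using i assms V_pos
    by (intro member_le_sum[of i "{..<N}" "\<lambda>i. int (dhat i) * V i j"]) (auto simp: less_imp_le)
  finally show ?thesis .
qed

lemma xiF_eq_lam_iff:
  assumes "m < N"
  shows "xiF N prox dhat f = lam N prox dhat f m \<longleftrightarrow> (\<forall>i<N. lam N prox dhat f m \<le> lam N prox dhat f i)"
  unfolding xiF_def using assms by (subst Min_eq_iff) auto

lemma Hset_pos:
  assumes "\<exists>i<N. 0 < dhat i" "m < N" "\<xi> \<in> Hset N prox dhat m"
  shows "0 < \<xi>"
proof -
  obtain f where f: "antinef N prox f" "\<xi> = lam N prox dhat f m" using assms(3) by (auto simp: Hset_def)
  have "0 < f m + kcoef N prox m + 1" using antinef_nonneg[OF f(1) assms(2)] kcoef_nonneg[OF assms(2)] by simp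
  then have "(0::rat) < of_int (f m + kcoef N prox m + 1)" by (simp only: of_int_0_less_iff)
  then show ?thesis using f(2) dcoef_pos[OF assms(1,2)] by (simp add: lam_def)
qed

lemma Hset_iff:
  assumes d: "\<exists>i<N. 0 < dhat i" and m: "m < N"
  shows "\<xi> \<in> Hset N prox dhat m \<longleftrightarrow>
    (\<exists>w. (\<forall>i<N. 2 - val i \<le> hat w i \<and> \<xi> * of_int (dcoef N prox dhat i) \<le> of_int (w i)) \<and>
      of_int (w m) = \<xi> * of_int (dcoef N prox dhat m))"
proof
  let ?d = "dcoef N prox dhat" and ?k = "\<lambda>i. kcoef N prox i + 1"
  have hk: "hat ?k i = 2 - val i" if "i < N" for i using k_adjunction[OF that] by (simp add: hat_def)
  have dpos: "(0::rat) < of_int (?d i)" if "i < N" for i using dcoef_pos[OF d that] by simp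
  have lam: "lam N prox dhat f i = of_int (f i + ?k i) / of_int (?d i)" for f i by (simp add: lam_def)
  {
    assume "\<xi> \<in> Hset N prox dhat m"
    then obtain f where f: "antinef N prox f" "\<xi> = lam N prox dhat f m"
        "\<forall>i<N. lam N prox dhat f m \<le> lam N prox dhat f i"
      unfolding Hset_def using xiF_eq_lam_iff[OF m] by auto
    define w where "w = (\<lambda>i. f i + ?k i)"
    have "hat w i = hat f i + (2 - val i)" if "i < N" for i
      using hat_add[of f ?k i] hk[OF that] unfolding w_def by linarith
    then have "2 - val i \<le> hat w i" if "i < N" for i using f(1) that by (simp add: antinef_iff)
    moreover have "\<xi> * of_int (?d i) \<le> of_int (w i)" if "i < N" for i
    proof -
      have "\<xi> \<le> of_int (w i) / of_int (?d i)" using f(2,3) that unfolding lam w_def by simp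
      then show ?thesis using dpos[OF that] by (simp only: pos_le_divide_eq)
    qed
    moreover have "of_int (w m) = \<xi> * of_int (?d m)"
      using dpos[OF m] unfolding f(2) lam w_def by simp
    ultimately show "\<exists>w. (\<forall>i<N. 2 - val i \<le> hat w i \<and> \<xi> * of_int (?d i) \<le> of_int (w i)) \<and>
      of_int (w m) = \<xi> * of_int (?d m)" by blast
  }
  {
    assume "\<exists>w. (\<forall>i<N. 2 - val i \<le> hat w i \<and> \<xi> * of_int (?d i) \<le> of_int (w i)) \<and>
      of_int (w m) = \<xi> * of_int (?d m)"
    then obtain w where w: "\<And>i. i < N \<Longrightarrow> 2 - val i \<le> hat w i"
      "\<And>i. i < N \<Longrightarrow> \<xi> * of_int (?d i) \<le> of_int (w i)" "of_int (w m) = \<xi> * of_int (?d m)" by blast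
    define f where "f i = w i - ?k i" for i
    have wf: "w = (\<lambda>i. f i + ?k i)" by (simp add: f_def)
    have "hat w i = hat f i + (2 - val i)" if "i < N" for i
      using hat_add[of f ?k i] hk[OF that] unfolding wf by linarith
    then have anti: "antinef N prox f" using w(1) unfolding antinef_iff by fastforce
    have lw: "lam N prox dhat f i = of_int (w i) / of_int (?d i)" for i unfolding lam f_def by simp
    have xi: "\<xi> = lam N prox dhat f m" using w(3) dpos[OF m] unfolding lw by simp
    have "\<xi> \<le> lam N prox dhat f i" if "i < N" for i
      using w(2)[OF that] dpos[OF that] unfolding lw by (simp add: pos_le_divide_eq)
    then have "xiF N prox dhat f = lam N prox dhat f m" using xiF_eq_lam_iff[OF m] xi by simp
    then show "\<xi> \<in> Hset N prox dhat m"
      unfolding Hset_def using anti xi by (intro CollectI exI[of _ f]) simp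
  }
qed

text \<open>The analogue of \<open>hat_edge\<close> with all edges leading outwards.\<close>

lemma hat_center:
  assumes "m < N"
  shows "V m m * hat w m = w m - (\<Sum>n | nb m n. V m m * w n - V n m * w m)"
proof -
  have "V m m * hat w m = (A m m * V m m) * w m - V m m * (\<Sum>n | nb m n. w n)"
    using assms by (simp add: hat_row algebra_simps)
  also have "\<dots> = (1 + (\<Sum>n | nb m n. V n m)) * w m - V m m * (\<Sum>n | nb m n. w n)"
    by (simp only: V_diag[OF assms])
  finally show ?thesis
    by (simp add: sum_subtractf sum_distrib_left sum_distrib_right algebra_simps)
qed

lemma hfun_eq:
  "hfun N prox dhat m \<xi> = of_int (dcoef N prox dhat m) * \<xi> + of_int ((val m - 2) * V m m)
    - of_int (\<Sum>n | nb m n. s m n * ceil_pos (\<xi> * of_int (T dhat m n) / of_int (s m n)))"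
proof -
  have "(\<Sum>i\<in>Br m n. of_nat (dhat i) * of_int (V m i) / of_nat (sgcd N prox m n)) * \<xi>
      = \<xi> * of_int (T dhat m n) / of_int (s m n)" for n
    by (simp add: T_def sum_divide_distrib[symmetric] mult.commute)
  then show ?thesis unfolding hfun_def by simp
qed

lemma hfun2_eq:
  assumes "dcoef N prox dhat m \<noteq> 0"
  shows "hfun2 N prox dhat m t = hfun N prox dhat m (t / of_int (dcoef N prox dhat m))"
proof -
  let ?d = "of_int (dcoef N prox dhat m) :: rat"
  have "t * (\<Sum>i\<in>B. x i / (y * ?d)) = (\<Sum>i\<in>B. x i / y) * (t / ?d)" for x y and B :: "nat set"
    unfolding sum_distrib_left sum_distrib_right by (rule sum.cong) (simp_all add: field_simps)
  then show ?thesis unfolding hfun_def hfun2_def using assms by simp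
qed

section \<open>Necessity and sufficiency of the semigroup condition\<close>

text \<open>The second bound is \<open>d_edge\<close> scaled by \<open>\<xi>\<close>, and it implies
  the first unless \<open>T dhat m n = 0\<close>. In that case \<open>dhat\<close> vanishes on the
  branch and \<open>d\<close> is there proportional to column \<open>m\<close> of \<open>V\<close>,
  so \<open>not_tight\<close> applies.\<close>

lemma branch_numerator_bounds:
  fixes \<xi> :: rat
  assumes "0 < \<xi>" "nb m n"
    and w: "\<And>i. i \<in> Br m n \<Longrightarrow> 2 - val i \<le> hat w i"
    and wd: "\<And>i. i \<in> Br m n \<Longrightarrow> \<xi> * of_int (dcoef N prox dhat i) \<le> of_int (w i)"
    and wm: "of_int (w m) = \<xi> * of_int (dcoef N prox dhat m)"
  shows "0 < V m m * w n - V n m * w m"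
    and "\<xi> * of_int (T dhat m n) \<le> of_int (V m m * w n - V n m * w m)"
proof -
  let ?d = "dcoef N prox dhat"
  have m: "m < N" and n: "n < N" using assms nb_less by blast+
  have "of_int (V m m) * (\<xi> * of_int (?d n)) \<le> of_int (V m m) * of_int (w n)"
    using wd[OF Br_self[OF assms(2)]] V_pos[OF m m] by (intro mult_left_mono) auto
  moreover have "\<xi> * of_int (T dhat m n) = of_int (V m m) * (\<xi> * of_int (?d n)) - of_int (V n m) * of_int (w m)"
    unfolding d_edge[OF assms(2), symmetric] wm by (simp add: algebra_simps)
  ultimately show le: "\<xi> * of_int (T dhat m n) \<le> of_int (V m m * w n - V n m * w m)" by simp
  show "0 < V m m * w n - V n m * w m"
  proof (cases "T dhat m n = 0")
    case False
    then have "0 < \<xi> * of_int (T dhat m n)" using T_nonneg[OF assms(2), of dhat] assms(1) by simp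
    then have "(0::rat) < of_int (V m m * w n - V n m * w m)" using le by linarith
    then show ?thesis by (simp only: of_int_0_less_iff)
  next
    case True
    have dhat0: "dhat i = 0" if "i \<in> Br m n" for i
    proof -
      have nonneg: "\<And>i. i \<in> Br m n \<Longrightarrow> 0 \<le> int (dhat i) * V m i"
        using V_pos[OF m] Br_less by (simp add: less_imp_le)
      have "int (dhat i) * V m i = 0"
        using True that sum_nonneg_eq_0_iff[of "Br m n" "\<lambda>i. int (dhat i) * V m i"] finite_Br nonneg
        unfolding T_def by blast
      then show ?thesis using V_pos[OF m Br_less[OF that]] by simp
    qed
    have scaled: "V m m * ?d i = V i m * ?d m" if i: "i \<in> Br m n" for i
    proof -
      have iN: "i < N" using Br_less i by blast
      have "int (dhat l) * (V m m * V l i) = int (dhat l) * (V i m * V l m)" if l: "l < N" for l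
      proof (cases "l \<in> Br m n")
        case False
        then show ?thesis using V_sep[OF i False l m] V_sym[of l i] V_sym[of l m] l iN m by simp
      qed (simp add: dhat0)
      then show ?thesis
        unfolding dcoef_def sum_distrib_left by (intro sum.cong) (simp_all add: algebra_simps)
    qed
    have "V i m * w m \<le> V m m * w i" if i: "i \<in> Br m n" for i
    proof -
      have "(of_int (V i m * w m) :: rat) = \<xi> * of_int (V m m * ?d i)" unfolding scaled[OF i] by (simp add: wm)
      also have "\<dots> = of_int (V m m) * (\<xi> * of_int (?d i))" by simp
      also have "\<dots> \<le> of_int (V m m) * of_int (w i)"
        using wd[OF i] V_pos[OF m m] by (intro mult_left_mono) auto
      also have "\<dots> = of_int (V m m * w i)" by simp
      finally show ?thesis by (simp only: of_int_le_iff)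
    qed
    then have "V n m * w m \<le> V m m * w n" "V m m * w n \<noteq> V n m * w m"
      using not_tight[OF assms(2) w] Br_self[OF assms(2)] by blast+
    then show ?thesis by simp
  qed
qed

lemma Hset_imp_hfun:
  assumes d: "\<exists>i<N. 0 < dhat i" and m: "m < N" and xi: "0 < \<xi>" and H: "\<xi> \<in> Hset N prox dhat m"
  shows "hfun N prox dhat m \<xi> \<in> of_nat ` Smon N prox m"
proof -
  let ?d = "dcoef N prox dhat"
  define e where "e n = ceil_pos (\<xi> * of_int (T dhat m n) / of_int (s m n))" for n
  obtain w where w: "\<And>i. i < N \<Longrightarrow> 2 - val i \<le> hat w i"
      "\<And>i. i < N \<Longrightarrow> \<xi> * of_int (?d i) \<le> of_int (w i)" "of_int (w m) = \<xi> * of_int (?d m)"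
    using H unfolding Hset_iff[OF d m] by blast
  let ?X = "\<lambda>n. V m m * w n - V n m * w m"
  define u where "u n = ?X n div s m n" for n
  have su: "s m n * u n = ?X n" if n: "nb m n" for n
  proof -
    have "s m n dvd V m m" "s m n dvd V n m"
      using s_dvd[OF m, of m n] s_dvd[OF m, of n n] Br_self[OF n] V_sym[OF m, of n] nb_less[OF n] by auto
    then have "s m n dvd ?X n" by (intro dvd_diff dvd_mult2)
    then show ?thesis unfolding u_def by (rule dvd_mult_div_cancel)
  qed
  \<comment> \<open>Because \<open>u n\<close> is an integer, positivity and the rational lower
    bound together round up to \<open>e n\<close>; positivity accounts for the maximum with 1 in
    \<open>ceil_pos\<close>.\<close>
  have ue: "e n \<le> u n" if n: "nb m n" for n
  proof -
    note b = branch_numerator_bounds[OF xi n w(1)[OF Br_less] w(2)[OF Br_less] w(3)]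
    have "0 < s m n * u n" "\<xi> * of_int (T dhat m n) \<le> of_int (s m n * u n)" using b su[OF n] by auto
    then have "1 \<le> u n" "\<xi> * of_int (T dhat m n) / of_int (s m n) \<le> of_int (u n)"
      using s_pos[OF m, of n] by (auto simp: zero_less_mult_iff pos_divide_le_eq mult.commute)
    then show ?thesis by (simp add: e_def ceil_pos_def ceiling_le_iff)
  qed
  have "hfun N prox dhat m \<xi> = of_int (w m + (val m - 2) * V m m - (\<Sum>n | nb m n. s m n * e n))"
    unfolding hfun_eq e_def[symmetric] by (simp add: w(3) mult.commute)
  \<comment> \<open>Eliminating \<open>w m\<close> by the balance at \<open>m\<close> leaves the
    slack at \<open>m\<close> and the excesses \<open>u n - e n\<close> as nonnegative coefficients
    of the generators.\<close>
  also have "w m = V m m * hat w m + (\<Sum>n | nb m n. s m n * u n)"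
    using hat_center[OF m, of w] by (simp add: su)
  finally have "hfun N prox dhat m \<xi> = of_int ((hat w m - (2 - val m)) * V m m + (\<Sum>n | nb m n. (u n - e n) * s m n))"
    by (simp add: sum_subtractf algebra_simps)
  also have "(hat w m - (2 - val m)) * V m m = int (nat (hat w m - (2 - val m)) * sgcd N prox m m)"
    using w(1)[OF m] s_center[OF m] by simp
  also have "(\<Sum>n | nb m n. (u n - e n) * s m n) = int (\<Sum>n | nb m n. nat (u n - e n) * sgcd N prox m n)"
    using ue by simp
  finally have "hfun N prox dhat m \<xi> = of_nat (nat (hat w m - (2 - val m)) * sgcd N prox m m
      + (\<Sum>n | nb m n. nat (u n - e n) * sgcd N prox m n))"
    by (simp only: of_int_add of_nat_add of_int_of_nat_eq)
  moreover have "nat (hat w m - (2 - val m)) * sgcd N prox m m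
      + (\<Sum>n | nb m n. nat (u n - e n) * sgcd N prox m n) \<in> Smon N prox m"
    unfolding Smon_iff[OF m] by (intro exI) (rule refl)
  ultimately show ?thesis by (rule image_eqI)
qed

lemma hfun_imp_Hset:
  assumes d: "\<exists>i<N. 0 < dhat i" and m: "m < N" and xi: "0 < \<xi>"
    and h: "hfun N prox dhat m \<xi> \<in> of_nat ` Smon N prox m"
  shows "\<xi> \<in> Hset N prox dhat m"
proof -
  let ?d = "dcoef N prox dhat"
  define e where "e n = ceil_pos (\<xi> * of_int (T dhat m n) / of_int (s m n))" for n
  obtain a c where ac: "hfun N prox dhat m \<xi>
      = of_nat (a * sgcd N prox m m + (\<Sum>n | nb m n. c n * sgcd N prox m n))"
    using h Smon_iff[OF m] by auto
  define u where "u n = e n + int (c n)" for n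
  \<comment> \<open>This is \<open>hat_center\<close> solved for the value at \<open>m\<close>, with
    slack \<open>a\<close> and numerators \<open>s m n * u n\<close> prescribed.\<close>
  define M where "M = (int a - (val m - 2)) * V m m + (\<Sum>n | nb m n. s m n * u n)"
  have "(of_nat (a * sgcd N prox m m + (\<Sum>n | nb m n. c n * sgcd N prox m n)) :: rat)
      = of_int (int a * V m m + (\<Sum>n | nb m n. s m n * int (c n)))"
    unfolding s_center[OF m, symmetric] by (simp add: mult.commute)
  with ac have "of_int (?d m) * \<xi> + of_int ((val m - 2) * V m m) - of_int (\<Sum>n | nb m n. s m n * e n)
      = of_int (int a * V m m + (\<Sum>n | nb m n. s m n * int (c n)))"
    unfolding hfun_eq e_def by simp
  then have M: "of_int M = \<xi> * of_int (?d m)"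
    unfolding M_def u_def by (simp add: sum.distrib algebra_simps)
  \<comment> \<open>The prescribed numerator determines the value at \<open>n\<close> as a quotient
    by \<open>V m m\<close>; expanding \<open>M\<close> shows that it is an integer.\<close>
  have dvd: "V m m dvd V n m * M + s m n * u n" if n: "nb m n" for n
  proof -
    let ?C = "{k. nb m k}"
    have "(\<Sum>k\<in>?C. s m k * u k) = s m n * u n + (\<Sum>k\<in>?C - {n}. s m k * u k)"
      using n by (intro sum.remove[OF finite_nb]) simp
    then have "V n m * M + s m n * u n = V m m * (V n m * (int a - (val m - 2)))
        + (1 + V n m) * s m n * u n + (\<Sum>k\<in>?C - {n}. V n m * s m k * u k)"
      unfolding M_def by (simp add: sum_distrib_left algebra_simps)
    also have "V m m dvd \<dots>"
      using V_dvd_s_edge[OF n] V_dvd_s_other[OF n] by (intro dvd_add dvd_sum) auto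
    finally show ?thesis .
  qed
  \<comment> \<open>The default \<open>M\<close> is meant for \<open>m\<close>; the branch vertices
    beyond the neighbours are overwritten by the extension.\<close>
  define w where "w i = (if nb m i then (V i m * M + s m i * u i) div V m m else M)" for i
  have wm: "w m = M" using nb_irrefl by (simp add: w_def)
  have wn: "V m m * w n - V n m * w m = s m n * u n" if "nb m n" for n
    using dvd[OF that] that wm by (simp add: w_def)
  have "\<exists>w'. (\<forall>i. i \<notin> Br m n - {n} \<longrightarrow> w' i = w i) \<and>
    (\<forall>i\<in>Br m n. 2 - val i \<le> hat w' i \<and> \<xi> * of_int (?d i) \<le> of_int (w' i))" if n: "n \<in> {n. nb m n}" for n
  proof (rule extend_branch)
    have sp: "0 < s m n" by (rule s_pos[OF m])
    have e: "1 \<le> e n" "\<xi> * of_int (T dhat m n) / of_int (s m n) \<le> of_int (e n)"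
      unfolding e_def ceil_pos_def by (simp, meson le_of_int_ceiling max.cobounded2 of_int_le_iff order_trans)
    then have "0 < u n" "\<xi> * of_int (T dhat m n) / of_int (s m n) \<le> of_int (u n)"
      unfolding u_def by (simp, simp add: add_increasing2)
    then have "0 < s m n * u n" "\<xi> * of_int (T dhat m n) \<le> of_int (s m n * u n)"
      using sp by (auto simp: pos_divide_le_eq mult.commute)
    then show "V n m * w m < V m m * w n" "\<xi> * of_int (T dhat m n) \<le> of_int (V m m * w n - V n m * w m)"
      using wn[of n] n by auto
  qed (use xi n M wm in auto)
  then have "\<exists>w'. (\<forall>i. i \<notin> (\<Union>n\<in>{n. nb m n}. Br m n - {n}) \<longrightarrow> w' i = w i) \<and>
    (\<forall>n\<in>{n. nb m n}. \<forall>i\<in>Br m n. 2 - val i \<le> hat w' i \<and> \<xi> * of_int (?d i) \<le> of_int (w' i))"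
    by (intro glue_branches[where R = "\<lambda>i h x. 2 - val i \<le> h \<and> \<xi> * of_int (?d i) \<le> of_int x"]) blast+
  then obtain w' where "\<forall>i. i \<notin> (\<Union>n\<in>{n. nb m n}. Br m n - {n}) \<longrightarrow> w' i = w i"
    "\<forall>n\<in>{n. nb m n}. \<forall>i\<in>Br m n. 2 - val i \<le> hat w' i \<and> \<xi> * of_int (?d i) \<le> of_int (w' i)"
    by (elim exE conjE)
  note off = this(1)[rule_format] and on = this(2)[THEN bspec, OF CollectI, THEN bspec]
  have w'm: "w' m = M" using off[of m] wm Br_center by blast
  have w'n: "w' n = w n" if n: "nb m n" for n
    using off[of n] Br_disjoint[OF n _ Br_self[OF n]] by blast
  have "V m m * hat w' m = M - (\<Sum>n | nb m n. s m n * u n)"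
    using hat_center[OF m, of w'] wn by (simp add: w'm w'n wm)
  then have "V m m * hat w' m = V m m * (int a - (val m - 2))" unfolding M_def by (simp add: mult.commute)
  then have "2 - val m \<le> hat w' m" using V_pos[OF m m] by simp
  then have "2 - val i \<le> hat w' i \<and> \<xi> * of_int (?d i) \<le> of_int (w' i)" if "i < N" for i
    using on Br_cover[OF m that] w'm M by (cases "i = m") auto
  then show ?thesis unfolding Hset_iff[OF d m] using w'm M by blast
qed

end

theorem mainTheorem1:
  fixes N :: nat and prox :: "nat \<Rightarrow> nat \<Rightarrow> bool" and dhat :: "nat \<Rightarrow> nat"
    and mu :: nat and xi :: rat
  assumes "valid_prox N prox"
    and "\<exists>i<N. dhat i > 0"
    and "mu < N"
    and "xi > 0"
  shows "(xi \<in> Hset N prox dhat mu \<longleftrightarrow> hfun N prox dhat mu xi \<in> of_nat ` Smon N prox mu)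
       \<and> Hset N prox dhat mu =
           {t / of_int (dcoef N prox dhat mu) | t. t > 0 \<and> hfun2 N prox dhat mu t \<in> of_nat ` Smon N prox mu}"
proof -
  interpret proximity N prox by unfold_locales (rule assms(1))
  let ?d = "of_int (dcoef N prox dhat mu) :: rat"
  have d: "0 < ?d" "dcoef N prox dhat mu \<noteq> 0" using dcoef_pos[OF assms(2,3)] by auto
  have iff: "x \<in> Hset N prox dhat mu \<longleftrightarrow> hfun N prox dhat mu x \<in> of_nat ` Smon N prox mu" if "0 < x" for x
    using Hset_imp_hfun[OF assms(2,3) that] hfun_imp_Hset[OF assms(2,3) that] by blast
  have "Hset N prox dhat mu =
    {t / ?d | t. t > 0 \<and> hfun2 N prox dhat mu t \<in> of_nat ` Smon N prox mu}" (is "_ = ?R")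
  proof (intro equalityI subsetI)
    fix x assume x: "x \<in> Hset N prox dhat mu"
    \<comment> \<open>All members of \<open>Hset\<close> are positive, so the restriction to
      \<open>t > 0\<close> loses nothing.\<close>
    have "0 < x" by (rule Hset_pos[OF assms(2,3) x])
    then show "x \<in> ?R" using x iff[of x] d
      by (intro CollectI exI[of _ "x * ?d"]) (simp add: hfun2_eq)
  next
    fix x assume "x \<in> ?R"
    then obtain t where "x = t / ?d" "0 < t" "hfun2 N prox dhat mu t \<in> of_nat ` Smon N prox mu" by blast
    then show "x \<in> Hset N prox dhat mu" using iff[of x] d by (simp add: hfun2_eq)
  qed
  then show ?thesis using iff[OF assms(4)] by blast
qed

end
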